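(* For any $\varepsilon>0$ and $m_0>0$ there exists $\delta>0$ (depending on $\varepsilon$) such that for all $m\in[0,m_0]$, all $t$ sufficiently large (depending on $\varepsilon$) and all $N$ sufficiently large (depending on $m_0,\varepsilon,t$), $$\mathbb{P}\left(\max_{u_N(x)\in I^{m,\delta}}\left(T_N(x)-4N+2^{4/3}N^{1/3}x^2\right)\ge2^{4/3}N^{1/3}t\right)\le e^{-\frac43(1-\varepsilon)t^{3/2}}.$$
   Context: Put i.i.d. $\mathrm{Exp}(1)$ weights on the vertices of $\mathbb{Z}^2$. For $x\in\mathbb{R}$ and $N\in\mathbb{N}$ let $u_N(x)=(N-\lfloor x(2N)^{2/3}\rfloor,\,N+\lfloor x(2N)^{2/3}\rfloor)\in\mathbb{Z}^2$, and let $T_N(x)$ be the maximal total weight (excluding the weight of the last vertex) of an up/right lattice path from $(0,0)$ to $u_N(x)$. For $m\ge0$, $\delta>0$, $I^{m,\delta}$ denotes the interval of length $\lfloor\delta(2N)^{2/3}\rfloor$ on the line $\{x+y=2N\}$ with midpoint $(N-\lfloor m(2N)^{2/3}\rfloor,\,N+\lfloor m(2N)^{2/3}\rfloor)$. Length along this line is measured by the change in one coordinate, so a segment of length $\ell$ with midpoint $p$ has endpoints $p\pm\frac{\ell}{2}(1,-1)$. The maximum is over all real $x$ with $u_N(x)\in I^{m,\delta}$ and is to be read as a supremum. *)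

theory Defs
  imports "HOL-Probability.Probability"
begin

definition up_right_paths :: "int \<times> int \<Rightarrow> int \<times> int \<Rightarrow> (int \<times> int) list set" where
  "up_right_paths a b =
     {p. p \<noteq> [] \<and> hd p = a \<and> last p = b \<and>
         successively (\<lambda>v v'. v' = v + (1, 0) \<or> v' = v + (0, 1)) p}"

text \<open>The use of \<open>butlast\<close> excludes the weight of the last vertex. The set of paths is finite;
  it is empty, and the value of \<open>Max\<close> unspecified, if \<open>b\<close> is not coordinatewise
  above \<open>a\<close>.\<close>

definition last_passage :: "(int \<times> int \<Rightarrow> real) \<Rightarrow> int \<times> int \<Rightarrow> int \<times> int \<Rightarrow> real" where
  "last_passage w a b = Max ((\<lambda>p. \<Sum>v\<leftarrow>butlast p. w v) ` up_right_paths a b)"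

definition u_pt :: "nat \<Rightarrow> real \<Rightarrow> int \<times> int" where
  "u_pt N x = (int N - \<lfloor>x * (2 * real N) powr (2 / 3)\<rfloor>,
               int N + \<lfloor>x * (2 * real N) powr (2 / 3)\<rfloor>)"

definition T_val :: "(int \<times> int \<Rightarrow> real) \<Rightarrow> nat \<Rightarrow> real \<Rightarrow> real" where
  "T_val w N x = last_passage w (0, 0) (u_pt N x)"

definition real_pt :: "int \<times> int \<Rightarrow> real \<times> real" where
  "real_pt v = (real_of_int (fst v), real_of_int (snd v))"

text \<open>The midpoint of the interval is \<open>u_pt N m\<close>. Length along the antidiagonal is the change in
  one coordinate, so half the length times \<open>(1, -1)\<close> leads from the midpoint to an endpoint.\<close>

definition I_seg :: "nat \<Rightarrow> real \<Rightarrow> real \<Rightarrow> (real \<times> real) set" where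
  "I_seg N m \<delta> =
     (let h = real_of_int \<lfloor>\<delta> * (2 * real N) powr (2 / 3)\<rfloor> / 2
      in closed_segment (real_pt (u_pt N m) - h *\<^sub>R (1, -1)) (real_pt (u_pt N m) + h *\<^sub>R (1, -1)))"

end

theory Submission
  imports Defs
begin

text \<open>Fix \<open>n = 2 * N\<close> and write \<open>T i\<close> for the passage time from the origin to the point \<open>(i, n - i)\<close> of
  the antidiagonal \<open>x + y = n\<close>. The idea is to put an artificial random boundary \<open>W\<close> on this
  antidiagonal, independent of the weights, with \<open>W 0 = 0\<close> and i.i.d. increments distributed as the
  difference of exponentials of rates \<open>w\<close> and \<open>1 - w\<close>, and to look at \<open>Max (T i + W i)\<close> over all \<open>i\<close>.

  This boundary is stationary. Computing the maximum inwards, one antidiagonal at a time, the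
  increments of the profile keep their law, and in each step the left end of the profile grows by an
  independent exponential of rate \<open>w\<close> (Burke's property, \<open>burke_vertex\<close> and \<open>burke_profile\<close>). So the
  maximum is a sum of \<open>n\<close> independent exponentials, and its exponential moment of order \<open>\<theta>\<close> is
  \<open>(w / (w - \<theta>)) ^ n\<close> (\<open>nn_integral_exp_growth\<close>).

  Conversely, if \<open>T i \<ge> x i\<close> for some \<open>i\<close> in a set \<open>S\<close>, then the moment given the weights is at least
  \<open>exp (\<theta> * x i)\<close> times the exponential moment of \<open>W i\<close>, which is an explicit \<open>i\<close>-th power. Markov's
  inequality thus bounds the probability that \<open>T i \<ge> x i\<close> for some \<open>i \<in> S\<close>, without a union bound
  and without any lower bound on passage times (\<open>passage_time_tail\<close>).

  It remains to choose the parameters. With \<open>\<theta> = s\<close> and \<open>w = (1 + y + s) / 2\<close>, the tilt \<open>y\<close> makes the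
  bound tangent to the parabola \<open>4 * N - k\<^sup>2 / N\<close> at the midpoint of the segment, and optimising over
  \<open>s\<close>, which is of order \<open>N powr (- 1 / 3)\<close>, gives \<open>- 4 / 3 * t powr (3 / 2)\<close> in the exponent
  (\<open>chernoff_exponent_le\<close>, \<open>segment_tail\<close>). Within a segment of scaled length \<open>1\<close> the parabola differs
  from its tangent by at most \<open>1 / 4\<close>, and this changes the exponent by at most a multiple of
  \<open>sqrt t\<close>, which \<open>\<epsilon>\<close> absorbs for large \<open>t\<close>. So \<open>\<delta> = 1\<close> works for every \<open>\<epsilon>\<close>.\<close>

section \<open>Exponential laws and the local Burke property\<close>

definition exp_law :: "real \<Rightarrow> real measure" where
  "exp_law l = density lborel (exponential_density l)"

text \<open>This is the law of \<open>J - I\<close> for independent \<open>J\<close> and \<open>I\<close> with exponential laws of rates \<open>w\<close> and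
  \<open>1 - w\<close>; since the rates add up to \<open>1\<close>, the density needs no further normalisation. The explicit
  density is the form in which the Burke property below is a change of variables; that the
  difference has this law is \<open>nn_integral_laplace_law\<close>.\<close>

definition laplace_law :: "real \<Rightarrow> real measure" where
  "laplace_law w =
     density lborel (\<lambda>d. ennreal (w * (1 - w) * exp (- (w * max d 0) - (1 - w) * max (- d) 0)))"

lemma sets_exp_law [measurable_cong, simp]: "sets (exp_law l) = sets borel"
  by (simp add: exp_law_def)

lemma space_exp_law [simp]: "space (exp_law l) = UNIV"
  by (simp add: exp_law_def)

lemma sets_laplace_law [measurable_cong, simp]: "sets (laplace_law w) = sets borel"
  by (simp add: laplace_law_def)

lemma space_laplace_law [simp]: "space (laplace_law w) = UNIV"
  by (simp add: laplace_law_def)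

lemma prob_space_exp_law: "0 < l \<Longrightarrow> prob_space (exp_law l)"
  unfolding exp_law_def by (rule prob_space_exponential_density)

lemma nn_integral_exp_law:
  assumes [measurable]: "f \<in> borel_measurable borel"
  shows "(\<integral>\<^sup>+x. f x \<partial>exp_law l) = (\<integral>\<^sup>+x. ennreal (exponential_density l x) * f x \<partial>lborel)"
  unfolding exp_law_def by (subst nn_integral_density) auto

lemma nn_integral_exp_law_mgf:
  assumes "0 < l" "\<theta> < l"
  shows "(\<integral>\<^sup>+x. ennreal (exp (\<theta> * x)) \<partial>exp_law l) = ennreal (l / (l - \<theta>))"
proof -
  have eq: "ennreal (exponential_density l x) * ennreal (exp (\<theta> * x)) =
      ennreal (l / (l - \<theta>)) * ennreal (exponential_density (l - \<theta>) x)" for x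
  proof -
    have "exp (- x * (l - \<theta>)) = exp (- x * l) * exp (\<theta> * x)"
      by (simp add: exp_add[symmetric] algebra_simps)
    then show ?thesis
      using assms by (auto simp: exponential_density_def ennreal_mult[symmetric])
  qed
  have "(\<integral>\<^sup>+x. ennreal (exponential_density (l - \<theta>) x) \<partial>lborel) = 1"
    using prob_space.emeasure_space_1[OF prob_space_exponential_density[of "l - \<theta>"]] assms
    by (simp add: emeasure_density)
  then show ?thesis
    using assms by (simp add: nn_integral_exp_law eq nn_integral_cmult)
qed

text \<open>For independent \<open>J\<close> and \<open>I\<close> with rates \<open>w\<close> and \<open>1 - w\<close>, the minimum has rate \<open>1\<close> and is
  independent of \<open>J - I\<close>. Read backwards: an increment \<open>d\<close> of the boundary profile together with a
  fresh weight \<open>x\<close> at the vertex next to it, one step closer to the origin, carries the same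
  information as the two gains \<open>x + max d 0\<close> and \<open>x + max (- d) 0\<close> seen from that vertex, and these
  gains are again independent exponentials. The proof splits the plane along \<open>j = i\<close>: on \<open>d \<ge> 0\<close> substitute \<open>j = x + d\<close>, on
  \<open>d < 0\<close> substitute \<open>i = x - d\<close>; the density of \<open>(d, x)\<close> is that of \<open>(j, i)\<close>.\<close>

lemma burke_vertex:
  assumes w: "0 < w" "w < 1"
    and g [measurable]: "case_prod g \<in> borel_measurable (borel \<Otimes>\<^sub>M borel)"
  shows "(\<integral>\<^sup>+d. \<integral>\<^sup>+x. g (x + max d 0) (x + max (- d) 0) \<partial>exp_law 1 \<partial>laplace_law w) =
         (\<integral>\<^sup>+j. \<integral>\<^sup>+i. g j i \<partial>exp_law (1 - w) \<partial>exp_law w)"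
proof -
  define F where "F j i = ennreal (exponential_density w j) *
      (ennreal (exponential_density (1 - w) i) * g j i)" for j i
  have [measurable]: "case_prod F \<in> borel_measurable (borel \<Otimes>\<^sub>M borel)"
    unfolding F_def by measurable
  have dens: "ennreal (w * (1 - w) * exp (- (w * max d 0) - (1 - w) * max (- d) 0)) *
        (ennreal (exponential_density 1 x) * g (x + max d 0) (x + max (- d) 0)) =
      F (x + max d 0) (x + max (- d) 0)" for d x
  proof (cases "x < 0")
    case True
    then have "exponential_density 1 x = 0"
      "exponential_density w (x + max d 0) = 0 \<or> exponential_density (1 - w) (x + max (- d) 0) = 0"
      by (auto simp: exponential_density_def)
    then show ?thesis by (auto simp: F_def)
  next
    case False
    then have "ennreal (w * (1 - w) * exp (- (w * max d 0) - (1 - w) * max (- d) 0)) *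
        ennreal (exponential_density 1 x) =
        ennreal (exponential_density w (x + max d 0)) *
        ennreal (exponential_density (1 - w) (x + max (- d) 0))"
      using w by (auto simp: exponential_density_def ennreal_mult[symmetric] exp_add[symmetric]
          algebra_simps)
    then show ?thesis by (simp add: F_def mult.assoc[symmetric])
  qed
  have shift1: "(\<integral>\<^sup>+d. (if 0 \<le> d then F (x + d) x else 0) \<partial>lborel) =
      (\<integral>\<^sup>+j. (if x \<le> j then F j x else 0) \<partial>lborel)" for x
    by (subst (2) nn_integral_real_affine[where c = 1 and t = x]) (simp_all cong: if_cong)
  have shift2: "(\<integral>\<^sup>+d. (if 0 \<le> d then 0 else F x (x - d)) \<partial>lborel) =
      (\<integral>\<^sup>+i. (if i \<le> x then 0 else F x i) \<partial>lborel)" for x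
    by (subst (2) nn_integral_real_affine[where c = "- 1" and t = x]) (simp_all cong: if_cong)
  have "(\<integral>\<^sup>+d. \<integral>\<^sup>+x. g (x + max d 0) (x + max (- d) 0) \<partial>exp_law 1 \<partial>laplace_law w) =
      (\<integral>\<^sup>+d. \<integral>\<^sup>+x. F (x + max d 0) (x + max (- d) 0) \<partial>lborel \<partial>lborel)"
    unfolding laplace_law_def
    by (subst nn_integral_density)
       (auto simp: nn_integral_exp_law nn_integral_cmult[symmetric] dens)
  also have "\<dots> = (\<integral>\<^sup>+d. \<integral>\<^sup>+x. (if 0 \<le> d then F (x + d) x else 0) +
      (if 0 \<le> d then 0 else F x (x - d)) \<partial>lborel \<partial>lborel)"
    by (intro nn_integral_cong) auto
  also have "\<dots> = (\<integral>\<^sup>+d. \<integral>\<^sup>+x. (if 0 \<le> d then F (x + d) x else 0) \<partial>lborel \<partial>lborel) +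
      (\<integral>\<^sup>+d. \<integral>\<^sup>+x. (if 0 \<le> d then 0 else F x (x - d)) \<partial>lborel \<partial>lborel)"
    by (subst nn_integral_add, measurable, subst nn_integral_add, measurable)
  also have "(\<integral>\<^sup>+d. \<integral>\<^sup>+x. (if 0 \<le> d then F (x + d) x else 0) \<partial>lborel \<partial>lborel) =
      (\<integral>\<^sup>+x. \<integral>\<^sup>+d. (if 0 \<le> d then F (x + d) x else 0) \<partial>lborel \<partial>lborel)"
    by (rule lborel_pair.Fubini') measurable
  also have "\<dots> = (\<integral>\<^sup>+x. \<integral>\<^sup>+j. (if x \<le> j then F j x else 0) \<partial>lborel \<partial>lborel)"
    by (simp only: shift1)
  also have "\<dots> = (\<integral>\<^sup>+j. \<integral>\<^sup>+i. (if i \<le> j then F j i else 0) \<partial>lborel \<partial>lborel)"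
    by (rule lborel_pair.Fubini') measurable
  also have "(\<integral>\<^sup>+d. \<integral>\<^sup>+x. (if 0 \<le> d then 0 else F x (x - d)) \<partial>lborel \<partial>lborel) =
      (\<integral>\<^sup>+x. \<integral>\<^sup>+d. (if 0 \<le> d then 0 else F x (x - d)) \<partial>lborel \<partial>lborel)"
    by (rule lborel_pair.Fubini') measurable
  also have "\<dots> = (\<integral>\<^sup>+j. \<integral>\<^sup>+i. (if i \<le> j then 0 else F j i) \<partial>lborel \<partial>lborel)"
    by (simp only: shift2)
  also have "(\<integral>\<^sup>+j. \<integral>\<^sup>+i. (if i \<le> j then F j i else 0) \<partial>lborel \<partial>lborel) + \<dots> =
      (\<integral>\<^sup>+j. \<integral>\<^sup>+i. (if i \<le> j then F j i else 0) + (if i \<le> j then 0 else F j i) \<partial>lborel \<partial>lborel)"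
    by (subst nn_integral_add[symmetric], measurable, subst nn_integral_add[symmetric], measurable)
  also have "\<dots> = (\<integral>\<^sup>+j. \<integral>\<^sup>+i. F j i \<partial>lborel \<partial>lborel)"
    by (intro nn_integral_cong) auto
  also have "(\<integral>\<^sup>+j. \<integral>\<^sup>+i. F j i \<partial>lborel \<partial>lborel) =
      (\<integral>\<^sup>+j. ennreal (exponential_density w j) *
        (\<integral>\<^sup>+i. ennreal (exponential_density (1 - w) i) * g j i \<partial>lborel) \<partial>lborel)"
    unfolding F_def by (intro nn_integral_cong nn_integral_cmult) measurable
  also have "\<dots> = (\<integral>\<^sup>+j. \<integral>\<^sup>+i. g j i \<partial>exp_law (1 - w) \<partial>exp_law w)"
    by (subst (1) nn_integral_exp_law[symmetric], measurable)
       (intro nn_integral_cong, subst nn_integral_exp_law, auto)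
  finally show ?thesis .
qed

text \<open>Apply the Burke property to a function of the difference of the two gains: that difference is \<open>d\<close>,
  and the weight integrates out.\<close>

lemma nn_integral_laplace_law:
  assumes w: "0 < w" "w < 1" and [measurable]: "h \<in> borel_measurable borel"
  shows "(\<integral>\<^sup>+d. h d \<partial>laplace_law w) =
         (\<integral>\<^sup>+j. \<integral>\<^sup>+i. h (j - i) \<partial>exp_law (1 - w) \<partial>exp_law w)"
proof -
  have "(x + max d 0) - (x + max (- d) 0) = d" for x d :: real by (simp add: max_def)
  then have "(\<integral>\<^sup>+d. \<integral>\<^sup>+x. h ((x + max d 0) - (x + max (- d) 0)) \<partial>exp_law 1 \<partial>laplace_law w) =
      (\<integral>\<^sup>+d. h d \<partial>laplace_law w)"
    using prob_space.emeasure_space_1[OF prob_space_exp_law[of 1]] by simp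
  then show ?thesis
    using burke_vertex[OF w, of "\<lambda>j i. h (j - i)"] by simp
qed

lemma prob_space_laplace_law:
  assumes w: "0 < w" "w < 1"
  shows "prob_space (laplace_law w)"
proof
  interpret E: prob_space "exp_law w" using w by (intro prob_space_exp_law)
  interpret E': prob_space "exp_law (1 - w)" using w by (intro prob_space_exp_law) auto
  show "emeasure (laplace_law w) (space (laplace_law w)) = 1"
    using nn_integral_laplace_law[OF w, of "\<lambda>_. 1"] E.emeasure_space_1 E'.emeasure_space_1 by simp
qed

lemma nn_integral_laplace_law_mgf:
  assumes "\<theta> > 0" "\<theta> < w" "w < 1"
  shows "(\<integral>\<^sup>+d. ennreal (exp (\<theta> * d)) \<partial>laplace_law w) =
         ennreal (w / (w - \<theta>) * ((1 - w) / (1 - w + \<theta>)))"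
proof -
  have "exp (\<theta> * (j - i)) = exp (\<theta> * j) * exp (- \<theta> * i)" for i j
    by (simp add: exp_add[symmetric] algebra_simps)
  then have "(\<integral>\<^sup>+d. ennreal (exp (\<theta> * d)) \<partial>laplace_law w) =
      (\<integral>\<^sup>+j. ennreal (exp (\<theta> * j)) * (\<integral>\<^sup>+i. ennreal (exp (- \<theta> * i)) \<partial>exp_law (1 - w)) \<partial>exp_law w)"
    using assms
    by (subst nn_integral_laplace_law) (simp_all add: ennreal_mult nn_integral_cmult)
  also have "(\<integral>\<^sup>+i. ennreal (exp (- \<theta> * i)) \<partial>exp_law (1 - w)) = ennreal ((1 - w) / (1 - w + \<theta>))"
    using assms nn_integral_exp_law_mgf[of "1 - w" "- \<theta>"] by simp
  also have "(\<integral>\<^sup>+j. ennreal (exp (\<theta> * j)) * ennreal ((1 - w) / (1 - w + \<theta>)) \<partial>exp_law w) =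
      ennreal (w / (w - \<theta>)) * ennreal ((1 - w) / (1 - w + \<theta>))"
    using assms by (subst nn_integral_multc) (auto simp: nn_integral_exp_law_mgf)
  finally show ?thesis
    using assms by (simp add: ennreal_mult[symmetric])
qed

section \<open>Stationarity of a boundary profile\<close>

abbreviation iid :: "'b measure \<Rightarrow> (nat \<Rightarrow> 'b) measure" where
  "iid M \<equiv> \<Pi>\<^sub>M _\<in>UNIV. M"

text \<open>Integration over an i.i.d. sequence, one coordinate at a time: the Burke property is transported
  along a profile by repeating this.\<close>

lemma nn_integral_iid_peel:
  assumes "prob_space M" and f [measurable]: "f \<in> borel_measurable (iid M)"
  shows "(\<integral>\<^sup>+\<omega>. f \<omega> \<partial>iid M) = (\<integral>\<^sup>+x. \<integral>\<^sup>+\<omega>. f (case_nat x \<omega>) \<partial>iid M \<partial>M)"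
proof -
  interpret prob_space M by fact
  interpret sequence_space M ..
  have [measurable]: "(\<lambda>(x, \<omega>). case_nat x \<omega>) \<in> M \<Otimes>\<^sub>M iid M \<rightarrow>\<^sub>M iid M"
    by measurable
  have "(\<integral>\<^sup>+\<omega>. f \<omega> \<partial>iid M) =
      (\<integral>\<^sup>+\<omega>. f \<omega> \<partial>distr (M \<Otimes>\<^sub>M iid M) (iid M) (\<lambda>(x, \<omega>). case_nat x \<omega>))"
    by (simp only: PiM_iter)
  also have "\<dots> = (\<integral>\<^sup>+p. f (case p of (x, \<omega>) \<Rightarrow> case_nat x \<omega>) \<partial>(M \<Otimes>\<^sub>M iid M))"
    by (subst nn_integral_distr) auto
  also have "\<dots> = (\<integral>\<^sup>+x. \<integral>\<^sup>+\<omega>. f (case_nat x \<omega>) \<partial>iid M \<partial>M)"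
    by (subst sigma_finite_measure.nn_integral_fst[symmetric,
          OF prob_space_imp_sigma_finite[OF prob_space_PiM]])
       (auto simp: split_beta' intro: assms(1))
  finally show ?thesis .
qed

lemma prob_space_iid: "prob_space M \<Longrightarrow> prob_space (iid M)"
  by (intro prob_space_PiM)

text \<open>Let \<open>V\<close> be a function on an antidiagonal, indexed by the first coordinate, with increments
  \<open>D i = V (i + 1) - V i\<close>, and let \<open>x\<close> be the weights on the antidiagonal one step closer to the
  origin. A path that maximises weight plus final \<open>V\<close> has value
  \<open>V' i = x i + max (V i) (V (i + 1))\<close> from vertex \<open>i\<close> of that line. The next three definitions give
  \<open>V' i - V i\<close>, \<open>V' i - V (i + 1)\<close> and the increments of \<open>V'\<close>. Sequences are infinite, so that the
  number of vertices on a line never has to be mentioned.\<close>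

definition gain_up :: "(nat \<Rightarrow> real) \<Rightarrow> (nat \<Rightarrow> real) \<Rightarrow> nat \<Rightarrow> real" where
  "gain_up D x i = x i + max (D i) 0"

definition gain_right :: "(nat \<Rightarrow> real) \<Rightarrow> (nat \<Rightarrow> real) \<Rightarrow> nat \<Rightarrow> real" where
  "gain_right D x i = x i + max (- D i) 0"

definition next_profile :: "(nat \<Rightarrow> real) \<Rightarrow> (nat \<Rightarrow> real) \<Rightarrow> nat \<Rightarrow> real" where
  "next_profile D x i = gain_up D x (Suc i) - gain_right D x i"

text \<open>After \<open>n\<close> inward steps this is the value at the origin minus the value of the initial profile at
  its left end \<open>(0, n)\<close>. The outermost line of weights is \<open>R 0\<close>.\<close>

fun growth :: "nat \<Rightarrow> (nat \<Rightarrow> real) \<Rightarrow> (nat \<Rightarrow> nat \<Rightarrow> real) \<Rightarrow> real" where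
  "growth 0 D R = 0"
| "growth (Suc n) D R = gain_up D (R 0) 0 + growth n (next_profile D (R 0)) (\<lambda>l. R (Suc l))"

lemma growth_cong: "(\<And>i. i < n \<Longrightarrow> D i = D' i) \<Longrightarrow> growth n D R = growth n D' R"
proof (induction n arbitrary: D D' R)
  case (Suc n)
  then have "growth n (next_profile D (R 0)) (\<lambda>l. R (Suc l)) =
      growth n (next_profile D' (R 0)) (\<lambda>l. R (Suc l))"
    by (intro Suc.IH) (auto simp: next_profile_def gain_up_def gain_right_def)
  with Suc.prems[of 0] show ?case by (simp add: gain_up_def)
qed simp

lemma measurable_gain_up [measurable (raw)]:
  assumes [measurable]: "D \<in> M \<rightarrow>\<^sub>M iid borel" "x \<in> M \<rightarrow>\<^sub>M iid borel"
  shows "(\<lambda>\<omega>. gain_up (D \<omega>) (x \<omega>) i) \<in> borel_measurable M"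
  unfolding gain_up_def by measurable

lemma measurable_next_profile [measurable (raw)]:
  assumes [measurable]: "D \<in> M \<rightarrow>\<^sub>M iid borel" "x \<in> M \<rightarrow>\<^sub>M iid borel"
  shows "(\<lambda>\<omega>. next_profile (D \<omega>) (x \<omega>)) \<in> M \<rightarrow>\<^sub>M iid borel"
  by (intro measurable_abs_UNIV) (simp add: next_profile_def gain_up_def gain_right_def)

lemma measurable_growth [measurable (raw)]:
  assumes "D \<in> M \<rightarrow>\<^sub>M iid borel" "R \<in> M \<rightarrow>\<^sub>M iid (iid borel)"
  shows "(\<lambda>\<omega>. growth n (D \<omega>) (R \<omega>)) \<in> borel_measurable M"
  using assms
proof (induction n arbitrary: D R)
  case (Suc n)
  note [measurable] = Suc.prems
  have [measurable]: "(\<lambda>\<omega> l. R \<omega> (Suc l)) \<in> M \<rightarrow>\<^sub>M iid (iid borel)"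
    by (intro measurable_abs_UNIV) measurable
  have [measurable]: "(\<lambda>\<omega>. growth n (next_profile (D \<omega>) (R \<omega> 0)) (\<lambda>l. R \<omega> (Suc l)))
      \<in> borel_measurable M"
    by (rule Suc.IH) measurable
  show ?case by simp
qed simp

lemma sets_iid_laplace [measurable_cong]: "sets (iid (laplace_law w)) = sets (iid borel)"
  by (intro sets_PiM_cong) auto

lemma sets_iid_exp [measurable_cong]: "sets (iid (exp_law w)) = sets (iid borel)"
  by (intro sets_PiM_cong) auto

lemma sets_iid_iid_exp [measurable_cong]: "sets (iid (iid (exp_law w))) = sets (iid (iid borel))"
  by (intro sets_PiM_cong sets_iid_exp) auto

lemma gain_up_case_nat: "gain_up (case_nat d D) (case_nat \<xi> x) 0 = \<xi> + max d 0"
  by (simp add: gain_up_def)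

lemma next_profile_case_nat:
  "next_profile (case_nat d D) (case_nat \<xi> x) =
     case_nat (gain_up D x 0 - (\<xi> + max (- d) 0)) (next_profile D x)"
  by (rule ext) (auto simp: next_profile_def gain_up_def gain_right_def split: nat.split)

text \<open>One inward step maps a profile with i.i.d. Laplace increments to a profile with the same law and
  raises the left end by an independent exponential. The reason is \<open>burke_vertex\<close>: all pairs of
  gains are independent, and each new increment combines the upward gain of one vertex with the
  rightward gain of its left neighbour, so that no gain is used twice and the very first upward gain
  is left over. The restriction to functions of the first \<open>k\<close> increments allows an induction over \<open>k\<close>, from left to
  right, that starts with a single vertex.\<close>

lemma burke_profile:
  assumes w: "0 < w" "w < 1"
    and "case_prod f \<in> borel_measurable (borel \<Otimes>\<^sub>M iid borel)"
    and "\<And>j D D'. (\<And>i. i < k \<Longrightarrow> D i = D' i) \<Longrightarrow> f j D = f j D'"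
  shows "(\<integral>\<^sup>+D. \<integral>\<^sup>+x. f (gain_up D x 0) (next_profile D x) \<partial>iid (exp_law 1) \<partial>iid (laplace_law w)) =
         (\<integral>\<^sup>+j. \<integral>\<^sup>+D. f j D \<partial>iid (laplace_law w) \<partial>exp_law w)"
  using assms(3,4)
proof (induction k arbitrary: f)
  interpret X: prob_space "exp_law 1" by (rule prob_space_exp_law) simp
  interpret J: prob_space "exp_law w" using w by (intro prob_space_exp_law)
  interpret I: prob_space "exp_law (1 - w)" using w by (intro prob_space_exp_law) auto
  interpret D: prob_space "laplace_law w" using w by (rule prob_space_laplace_law)
  interpret XS: prob_space "iid (exp_law 1)" by (rule prob_space_iid) unfold_locales
  interpret DS: prob_space "iid (laplace_law w)" by (rule prob_space_iid) unfold_locales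
  interpret swap1: pair_sigma_finite "exp_law 1" "iid (laplace_law w)" ..
  interpret swap2: pair_sigma_finite "exp_law w" "exp_law (1 - w)" ..
  have peel: "(\<integral>\<^sup>+D. \<integral>\<^sup>+x. f (gain_up D x 0) (next_profile D x)
        \<partial>iid (exp_law 1) \<partial>iid (laplace_law w)) =
      (\<integral>\<^sup>+d. \<integral>\<^sup>+\<xi>. \<integral>\<^sup>+D. \<integral>\<^sup>+x. f (\<xi> + max d 0)
          (case_nat (gain_up D x 0 - (\<xi> + max (- d) 0)) (next_profile D x))
        \<partial>iid (exp_law 1) \<partial>iid (laplace_law w) \<partial>exp_law 1 \<partial>laplace_law w)"
    if f [measurable]: "case_prod f \<in> borel_measurable (borel \<Otimes>\<^sub>M iid borel)" for f
  proof -
    have "(\<integral>\<^sup>+x. f (gain_up D x 0) (next_profile D x) \<partial>iid (exp_law 1)) =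
        (\<integral>\<^sup>+\<xi>. \<integral>\<^sup>+x. f (gain_up D (case_nat \<xi> x) 0) (next_profile D (case_nat \<xi> x))
          \<partial>iid (exp_law 1) \<partial>exp_law 1)" if "D \<in> space (iid borel)" for D
      using that by (intro nn_integral_iid_peel) (unfold_locales, measurable)
    then have "(\<integral>\<^sup>+D. \<integral>\<^sup>+x. f (gain_up D x 0) (next_profile D x)
          \<partial>iid (exp_law 1) \<partial>iid (laplace_law w)) =
        (\<integral>\<^sup>+D. \<integral>\<^sup>+\<xi>. \<integral>\<^sup>+x. f (gain_up D (case_nat \<xi> x) 0) (next_profile D (case_nat \<xi> x))
          \<partial>iid (exp_law 1) \<partial>exp_law 1 \<partial>iid (laplace_law w))"
      by (intro nn_integral_cong) (auto simp: space_PiM)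
    also have "\<dots> = (\<integral>\<^sup>+d. \<integral>\<^sup>+D. \<integral>\<^sup>+\<xi>. \<integral>\<^sup>+x.
          f (gain_up (case_nat d D) (case_nat \<xi> x) 0) (next_profile (case_nat d D) (case_nat \<xi> x))
          \<partial>iid (exp_law 1) \<partial>exp_law 1 \<partial>iid (laplace_law w) \<partial>laplace_law w)"
      by (intro nn_integral_iid_peel) (unfold_locales, measurable)
    finally show ?thesis
      unfolding gain_up_case_nat next_profile_case_nat
      by (subst (asm) swap1.Fubini') auto
  qed
  {
    case 0
    note f [measurable] = 0(1)
    have [measurable]: "(\<lambda>_. 0) \<in> space (iid (borel :: real measure))"
      by (simp add: space_PiM)
    have const: "f j D = f j (\<lambda>_. 0)" for j D by (rule 0) simp
    have "(\<integral>\<^sup>+D. \<integral>\<^sup>+x. f (gain_up D x 0) (next_profile D x)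
          \<partial>iid (exp_law 1) \<partial>iid (laplace_law w)) =
        (\<integral>\<^sup>+d. \<integral>\<^sup>+\<xi>. f (\<xi> + max d 0) (\<lambda>_. 0) \<partial>exp_law 1 \<partial>laplace_law w)"
      unfolding peel[OF f] by (subst const) (simp add: DS.emeasure_space_1 XS.emeasure_space_1)
    also have "\<dots> = (\<integral>\<^sup>+j. \<integral>\<^sup>+i. f j (\<lambda>_. 0) \<partial>exp_law (1 - w) \<partial>exp_law w)"
      by (rule burke_vertex[OF w]) measurable
    also have "\<dots> = (\<integral>\<^sup>+j. f j (\<lambda>_. 0) \<partial>exp_law w)"
      using I.emeasure_space_1 by simp
    also have "\<dots> = (\<integral>\<^sup>+j. \<integral>\<^sup>+D. f j D \<partial>iid (laplace_law w) \<partial>exp_law w)"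
      by (subst (2) const) (simp add: DS.emeasure_space_1)
    finally show ?case .
  next
    case (Suc k)
    note f [measurable] = Suc.prems(1)
    have "(\<integral>\<^sup>+D. \<integral>\<^sup>+x. f j' (case_nat (gain_up D x 0 - i') (next_profile D x))
          \<partial>iid (exp_law 1) \<partial>iid (laplace_law w)) =
        (\<integral>\<^sup>+j. \<integral>\<^sup>+D. f j' (case_nat (j - i') D) \<partial>iid (laplace_law w) \<partial>exp_law w)" for i' j'
      by (rule Suc.IH) (measurable, auto intro!: Suc.prems(2) split: nat.split)
    then have "(\<integral>\<^sup>+D. \<integral>\<^sup>+x. f (gain_up D x 0) (next_profile D x)
          \<partial>iid (exp_law 1) \<partial>iid (laplace_law w)) =
        (\<integral>\<^sup>+d. \<integral>\<^sup>+\<xi>. \<integral>\<^sup>+j. \<integral>\<^sup>+D. f (\<xi> + max d 0) (case_nat (j - (\<xi> + max (- d) 0)) D)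
          \<partial>iid (laplace_law w) \<partial>exp_law w \<partial>exp_law 1 \<partial>laplace_law w)"
      unfolding peel[OF f] by simp
    also have "\<dots> = (\<integral>\<^sup>+j'. \<integral>\<^sup>+i'. \<integral>\<^sup>+j. \<integral>\<^sup>+D. f j' (case_nat (j - i') D)
        \<partial>iid (laplace_law w) \<partial>exp_law w \<partial>exp_law (1 - w) \<partial>exp_law w)"
      by (rule burke_vertex[OF w]) measurable
    also have "\<dots> = (\<integral>\<^sup>+j'. \<integral>\<^sup>+j. \<integral>\<^sup>+i'. \<integral>\<^sup>+D. f j' (case_nat (j - i') D)
        \<partial>iid (laplace_law w) \<partial>exp_law (1 - w) \<partial>exp_law w \<partial>exp_law w)"
      by (subst swap2.Fubini') auto
    also have "\<dots> = (\<integral>\<^sup>+j'. \<integral>\<^sup>+d. \<integral>\<^sup>+D. f j' (case_nat d D)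
        \<partial>iid (laplace_law w) \<partial>laplace_law w \<partial>exp_law w)"
      by (subst nn_integral_laplace_law[OF w]) auto
    also have "\<dots> = (\<integral>\<^sup>+j'. \<integral>\<^sup>+D. f j' D \<partial>iid (laplace_law w) \<partial>exp_law w)"
      by (subst nn_integral_iid_peel) (auto intro: D.prob_space_axioms)
    finally show ?case .
  }
qed

text \<open>By stationarity each inward step contributes an independent exponential of rate \<open>w\<close>: with a
  stationary boundary, the passage time is distributed exactly like a sum of \<open>n\<close> of them.\<close>

lemma nn_integral_exp_growth:
  assumes \<theta>: "0 < \<theta>" "\<theta> < w" "w < 1"
  shows "(\<integral>\<^sup>+R. \<integral>\<^sup>+D. ennreal (exp (\<theta> * growth n D R)) \<partial>iid (laplace_law w) \<partial>iid (iid (exp_law 1))) =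
         ennreal ((w / (w - \<theta>)) ^ n)"
proof (induction n)
  have w: "0 < w" "w < 1" using \<theta> by auto
  interpret X: prob_space "exp_law 1" by (rule prob_space_exp_law) simp
  interpret J: prob_space "exp_law w" using w by (intro prob_space_exp_law)
  interpret D: prob_space "laplace_law w" using w by (rule prob_space_laplace_law)
  interpret XS: prob_space "iid (exp_law 1)" by (rule prob_space_iid) unfold_locales
  interpret DS: prob_space "iid (laplace_law w)" by (rule prob_space_iid) unfold_locales
  interpret RS: prob_space "iid (iid (exp_law 1))" by (rule prob_space_iid) unfold_locales
  interpret swap1: pair_sigma_finite "iid (exp_law 1)" "iid (laplace_law w)" ..
  interpret swap2: pair_sigma_finite "iid (exp_law 1)" "iid (iid (exp_law 1))" ..
  {
    case 0
    show ?case by (simp add: DS.emeasure_space_1 RS.emeasure_space_1)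
  next
    case (Suc n)
    have row: "(\<integral>\<^sup>+x. \<integral>\<^sup>+D. ennreal (exp (\<theta> * (gain_up D x 0 + growth n (next_profile D x) R)))
          \<partial>iid (laplace_law w) \<partial>iid (exp_law 1)) =
        ennreal (w / (w - \<theta>)) *
          (\<integral>\<^sup>+D. ennreal (exp (\<theta> * growth n D R)) \<partial>iid (laplace_law w))"
      if [measurable]: "R \<in> space (iid (iid borel))" for R
    proof -
      have "(\<integral>\<^sup>+x. \<integral>\<^sup>+D. ennreal (exp (\<theta> * (gain_up D x 0 + growth n (next_profile D x) R)))
            \<partial>iid (laplace_law w) \<partial>iid (exp_law 1)) =
          (\<integral>\<^sup>+D. \<integral>\<^sup>+x. ennreal (exp (\<theta> * (gain_up D x 0 + growth n (next_profile D x) R)))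
            \<partial>iid (exp_law 1) \<partial>iid (laplace_law w))"
        by (subst swap1.Fubini') auto
      also have "\<dots> = (\<integral>\<^sup>+j. \<integral>\<^sup>+D. ennreal (exp (\<theta> * (j + growth n D R)))
          \<partial>iid (laplace_law w) \<partial>exp_law w)"
        by (rule burke_profile[OF w, where k = n]) (measurable, metis growth_cong)
      also have "\<dots> = (\<integral>\<^sup>+j. ennreal (exp (\<theta> * j)) *
          (\<integral>\<^sup>+D. ennreal (exp (\<theta> * growth n D R)) \<partial>iid (laplace_law w)) \<partial>exp_law w)"
        by (subst nn_integral_cmult[symmetric])
           (auto simp: ennreal_mult[symmetric] exp_add[symmetric] ring_distribs)
      also have "\<dots> = ennreal (w / (w - \<theta>)) *
          (\<integral>\<^sup>+D. ennreal (exp (\<theta> * growth n D R)) \<partial>iid (laplace_law w))"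
        using \<theta> by (subst nn_integral_multc) (auto simp: nn_integral_exp_law_mgf)
      finally show ?thesis .
    qed
    have "(\<integral>\<^sup>+R. \<integral>\<^sup>+D. ennreal (exp (\<theta> * growth (Suc n) D R))
          \<partial>iid (laplace_law w) \<partial>iid (iid (exp_law 1))) =
        (\<integral>\<^sup>+x. \<integral>\<^sup>+R. \<integral>\<^sup>+D. ennreal (exp (\<theta> * growth (Suc n) D (case_nat x R)))
          \<partial>iid (laplace_law w) \<partial>iid (iid (exp_law 1)) \<partial>iid (exp_law 1))"
      by (intro nn_integral_iid_peel XS.prob_space_axioms) measurable
    also have "\<dots> = (\<integral>\<^sup>+R. \<integral>\<^sup>+x. \<integral>\<^sup>+D.
          ennreal (exp (\<theta> * (gain_up D x 0 + growth n (next_profile D x) R)))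
          \<partial>iid (laplace_law w) \<partial>iid (exp_law 1) \<partial>iid (iid (exp_law 1)))"
      by (subst swap2.Fubini') auto
    also have "\<dots> = (\<integral>\<^sup>+R. ennreal (w / (w - \<theta>)) *
          (\<integral>\<^sup>+D. ennreal (exp (\<theta> * growth n D R)) \<partial>iid (laplace_law w)) \<partial>iid (iid (exp_law 1)))"
      by (intro nn_integral_cong row) (simp add: space_PiM)
    also have "\<dots> = ennreal (w / (w - \<theta>)) * ennreal ((w / (w - \<theta>)) ^ n)"
      by (simp add: nn_integral_cmult Suc.IH)
    finally show ?case
      using \<theta> by (simp add: ennreal_mult[symmetric])
  }
qed

lemma nn_integral_laplace_walk_mgf:
  assumes \<theta>: "0 < \<theta>" "\<theta> < w" "w < 1"
  shows "(\<integral>\<^sup>+D. ennreal (exp (\<theta> * (\<Sum>l<i. D l))) \<partial>iid (laplace_law w)) =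
         ennreal ((w / (w - \<theta>) * ((1 - w) / (1 - w + \<theta>))) ^ i)"
proof (induction i)
  have w: "0 < w" "w < 1" using \<theta> by auto
  interpret D: prob_space "laplace_law w" using w by (rule prob_space_laplace_law)
  interpret DS: prob_space "iid (laplace_law w)" by (rule prob_space_iid) unfold_locales
  {
    case 0
    show ?case by (simp add: DS.emeasure_space_1)
  next
    case (Suc i)
    have "(\<integral>\<^sup>+D. ennreal (exp (\<theta> * (\<Sum>l<Suc i. D l))) \<partial>iid (laplace_law w)) =
        (\<integral>\<^sup>+d. \<integral>\<^sup>+D. ennreal (exp (\<theta> * (\<Sum>l<Suc i. case_nat d D l)))
          \<partial>iid (laplace_law w) \<partial>laplace_law w)"
      by (intro nn_integral_iid_peel D.prob_space_axioms) measurable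
    also have "\<dots> = (\<integral>\<^sup>+d. ennreal (exp (\<theta> * d)) *
        (\<integral>\<^sup>+D. ennreal (exp (\<theta> * (\<Sum>l<i. D l))) \<partial>iid (laplace_law w)) \<partial>laplace_law w)"
      by (subst nn_integral_cmult[symmetric])
         (auto simp: sum.lessThan_Suc_shift ennreal_mult[symmetric] exp_add[symmetric] ring_distribs
               simp del: sum.lessThan_Suc)
    also have "\<dots> = ennreal (w / (w - \<theta>) * ((1 - w) / (1 - w + \<theta>))) *
        ennreal ((w / (w - \<theta>) * ((1 - w) / (1 - w + \<theta>))) ^ i)"
      unfolding Suc.IH using \<theta> by (subst nn_integral_multc) (auto simp: nn_integral_laplace_law_mgf)
    finally show ?case
      using \<theta> by (simp add: ennreal_mult[symmetric])
  }
qed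

section \<open>Passage times and the growth of a profile\<close>

text \<open>Line \<open>l\<close> is used in inward step \<open>l\<close>, so \<open>l = 0\<close> is the line \<open>x + y = n - 1\<close>. Lines are continued
  below the axis and indices \<open>l \<ge> n\<close> are kept, which is harmless because the map is injective over
  the integers.\<close>

definition antidiagonal :: "nat \<Rightarrow> nat \<Rightarrow> nat \<Rightarrow> int \<times> int" where
  "antidiagonal n l i = (int i, int n - 1 - int l - int i)"

lemma inj_antidiagonal: "inj (antidiagonal n l)"
  by (auto simp: inj_def antidiagonal_def)

text \<open>Disjoint blocks of independent weights are independent, so the lines form an i.i.d. sequence of
  i.i.d. sequences. In this form one line after the other can be integrated out.\<close>

lemma distr_antidiagonals:
  fixes X :: "int \<times> int \<Rightarrow> 'a \<Rightarrow> real"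
  assumes "prob_space M"
    and indep: "prob_space.indep_vars M (\<lambda>_. borel) X UNIV"
    and exp: "\<And>v. distributed M lborel (X v) (\<lambda>s. ennreal (exponential_density 1 s))"
  shows "distr M (iid (iid borel)) (\<lambda>\<omega> l i. X (antidiagonal n l i) \<omega>) = iid (iid (exp_law 1))"
proof -
  interpret prob_space M by fact
  have X [measurable]: "X v \<in> borel_measurable M" for v
    using distributed_measurable[OF exp] by simp
  have law: "distr M borel (X v) = exp_law 1" for v
  proof -
    have "distr M borel (X v) = distr M lborel (X v)" by (intro distr_cong) auto
    then show ?thesis by (simp add: distributed_distr_eq_density[OF exp] exp_law_def)
  qed
  have row_meas [measurable]: "(\<lambda>\<omega> i. X (antidiagonal n l i) \<omega>) \<in> M \<rightarrow>\<^sub>M iid borel" for l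
    by (intro measurable_abs_UNIV) simp
  have row_law: "distr M (iid borel) (\<lambda>\<omega> i. X (antidiagonal n l i) \<omega>) = iid (exp_law 1)" for l
  proof -
    have all: "distr M (PiM UNIV (\<lambda>_. borel)) (\<lambda>\<omega> v. X v \<omega>) = PiM UNIV (\<lambda>_. exp_law 1)"
      using indep by (subst (asm) indep_vars_iff_distr_eq_PiM) (auto simp: law restrict_UNIV)
    have "distr M (iid borel) (\<lambda>\<omega> i. X (antidiagonal n l i) \<omega>) =
        distr (distr M (PiM UNIV (\<lambda>_. borel)) (\<lambda>\<omega> v. X v \<omega>)) (iid borel)
          (\<lambda>h i. h (antidiagonal n l i))"
      by (subst distr_distr) (auto simp: comp_def intro!: measurable_abs_UNIV)
    also have "\<dots> = distr (PiM UNIV (\<lambda>_. exp_law 1)) (iid (exp_law 1))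
          (\<lambda>h. \<lambda>i\<in>UNIV. h (antidiagonal n l i))"
      unfolding all by (intro distr_cong) (simp_all add: sets_iid_exp restrict_UNIV)
    also have "\<dots> = iid (exp_law 1)"
      by (rule distr_PiM_reindex) (auto intro: prob_space_exp_law inj_antidiagonal)
    finally show ?thesis .
  qed
  define K where "K l = range (antidiagonal n l)" for l
  have "indep_vars (\<lambda>l. PiM (K l) (\<lambda>_. borel)) (\<lambda>l \<omega>. restrict (\<lambda>v. X v \<omega>) (K l)) UNIV"
    by (rule indep_vars_restrict[OF indep])
       (auto simp: K_def disjoint_family_on_def antidiagonal_def)
  then have "indep_vars (\<lambda>_. iid borel)
      (\<lambda>l \<omega>. (\<lambda>h i. h (antidiagonal n l i)) (restrict (\<lambda>v. X v \<omega>) (K l))) UNIV"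
  proof (rule indep_vars_compose2)
    show "(\<lambda>h i. h (antidiagonal n l i)) \<in> PiM (K l) (\<lambda>_. borel) \<rightarrow>\<^sub>M iid borel" for l
      by (intro measurable_abs_UNIV measurable_component_singleton) (simp add: K_def)
  qed
  then have "indep_vars (\<lambda>_. iid borel) (\<lambda>l \<omega> i. X (antidiagonal n l i) \<omega>) UNIV"
    by (simp add: K_def)
  then show ?thesis
    by (subst (asm) indep_vars_iff_distr_eq_PiM) (auto simp: row_law restrict_UNIV)
qed

lemma finite_up_right_paths: "finite (up_right_paths a b)"
proof -
  have "set p \<subseteq> {fst (hd p)..fst (last p)} \<times> {snd (hd p)..snd (last p)} \<and>
      int (length p) = fst (last p) + snd (last p) - fst (hd p) - snd (hd p) + 1"
    if "p \<noteq> []" "successively (\<lambda>v v'. v' = v + (1, 0) \<or> v' = v + (0, 1)) p" for p :: "(int \<times> int) list"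
    using that
  proof (induction p rule: induct_list012)
    case (3 x y zs)
    then have IH: "set (y # zs) \<subseteq> {fst y..fst (last (y # zs))} \<times> {snd y..snd (last (y # zs))}"
      and len: "int (length (y # zs)) = fst (last (y # zs)) + snd (last (y # zs)) - fst y - snd y + 1"
      and xy: "y = x + (1, 0) \<or> y = x + (0, 1)"
      by auto
    from xy have le: "fst x \<le> fst y" "snd x \<le> snd y" by auto
    have "y \<in> set (y # zs)" by simp
    with IH have "fst y \<le> fst (last (y # zs))" "snd y \<le> snd (last (y # zs))" by auto
    then have "set (x # y # zs) \<subseteq> {fst x..fst (last (y # zs))} \<times> {snd x..snd (last (y # zs))}"
      using IH le by (cases x) force
    moreover have "int (length (x # y # zs)) =
        fst (last (y # zs)) + snd (last (y # zs)) - fst x - snd x + 1"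
      using len xy by auto
    ultimately show ?case by simp
  qed auto
  then have "up_right_paths a b \<subseteq> {p. set p \<subseteq> {fst a..fst b} \<times> {snd a..snd b} \<and>
      length p = nat (fst b + snd b - fst a - snd a + 1)}"
    by (fastforce simp: up_right_paths_def)
  then show ?thesis
    by (rule finite_subset) (intro finite_lists_length_eq finite_cartesian_product finite_atLeastAtMost_int)
qed

lemma up_right_paths_nonempty: "0 \<le> a \<Longrightarrow> 0 \<le> b \<Longrightarrow> up_right_paths (0, 0) (a, b) \<noteq> {}"
proof -
  let ?step = "\<lambda>v v'. v' = v + (1, 0) \<or> v' = v + (0, 1 :: int)"
  have ext: "up_right_paths u (v + e) \<noteq> {}"
    if e: "e = (1, 0) \<or> e = (0, 1)" and "up_right_paths u v \<noteq> {}" for u v e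
  proof -
    from that obtain p where p: "p \<noteq> []" "hd p = u" "last p = v" "successively ?step p"
      by (auto simp: up_right_paths_def)
    then have "p @ [v + e] \<in> up_right_paths u (v + e)"
      using e by (auto simp: up_right_paths_def successively_append_iff)
    then show ?thesis by blast
  qed
  have "[(0, 0)] \<in> up_right_paths (0, 0) (0, 0)" by (simp add: up_right_paths_def)
  then have "up_right_paths (0, 0) (int m, 0) \<noteq> {}" for m
  proof (induction m)
    case (Suc m)
    then show ?case using ext[of "(1, 0)" "(0, 0)" "(int m, 0)"] by (simp add: add.commute)
  qed auto
  then have "up_right_paths (0, 0) (int m, int n) \<noteq> {}" for m n
  proof (induction n)
    case (Suc n)
    then show ?case using ext[of "(0, 1)" "(0, 0)" "(int m, int n)"] by (simp add: add.commute)
  qed auto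
  from this[of "nat a" "nat b"] show "0 \<le> a \<Longrightarrow> 0 \<le> b \<Longrightarrow> ?thesis" by simp
qed

lemma antidiagonal_Suc: "antidiagonal (Suc n) (Suc l) i = antidiagonal n l i"
  by (simp add: antidiagonal_def)

text \<open>Both sides are \<open>V' a - V 0\<close>.\<close>

lemma sum_next_profile:
  "gain_up D x 0 + (\<Sum>l<a. next_profile D x l) = gain_up D x a + (\<Sum>l<a. D l)"
  by (induction a) (auto simp: next_profile_def gain_up_def gain_right_def max_def)

text \<open>The path is read from its last step, because the outermost weights enter first: the last vertex
  only selects a boundary value, and the one before it lies on the outermost line of weights.\<close>

lemma path_weight_le_growth:
  assumes "p \<noteq> []" "hd p = (0, 0)" "successively (\<lambda>v v'. v' = v + (1, 0) \<or> v' = v + (0, 1)) p"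
  shows "\<exists>a b. last p = (int a, int b) \<and>
    (\<forall>D. (\<Sum>v\<leftarrow>butlast p. w v) + (\<Sum>l<a. D l) \<le>
       growth (a + b) D (\<lambda>l i. w (antidiagonal (a + b) l i)))"
  using assms
proof (induction p rule: rev_induct)
  case (snoc v q)
  show ?case
  proof (cases "q = []")
    case True
    with snoc.prems have "v = (int 0, int 0)" by simp
    with True show ?thesis by (intro exI[of _ 0]) simp
  next
    case False
    with snoc.prems have q: "hd q = (0, 0)"
      "successively (\<lambda>v v'. v' = v + (1, 0) \<or> v' = v + (0, 1)) q"
      and v: "v = last q + (1, 0) \<or> v = last q + (0, 1)"
      by (auto simp: successively_append_iff)
    obtain a b where last: "last q = (int a, int b)"
      and IH: "(\<Sum>v\<leftarrow>butlast q. w v) + (\<Sum>l<a. D l) \<le>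
        growth (a + b) D (\<lambda>l i. w (antidiagonal (a + b) l i))" for D
      using snoc.IH[OF False q] by blast
    have "(\<Sum>u\<leftarrow>q. w u) = (\<Sum>u\<leftarrow>butlast q @ [last q]. w u)"
      using False by simp
    then have sum_q: "(\<Sum>u\<leftarrow>q. w u) = (\<Sum>u\<leftarrow>butlast q. w u) + w (int a, int b)"
      unfolding last by (simp only: map_append sum_list_append) simp
    have step: "(\<Sum>u\<leftarrow>q. w u) + max (D a) 0 + (\<Sum>l<a. D l) \<le>
        growth (Suc (a + b)) D (\<lambda>l i. w (antidiagonal (Suc (a + b)) l i))" for D
    proof -
      let ?x = "\<lambda>i. w (antidiagonal (Suc (a + b)) 0 i)"
      have "?x a = w (int a, int b)" by (simp add: antidiagonal_def)
      then have "w (int a, int b) + max (D a) 0 + (\<Sum>l<a. D l) =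
          gain_up D ?x 0 + (\<Sum>l<a. next_profile D ?x l)"
        unfolding sum_next_profile by (simp add: gain_up_def)
      with IH[of "next_profile D ?x"] show ?thesis
        by (simp add: sum_q antidiagonal_Suc)
    qed
    from v show ?thesis
    proof
      assume v: "v = last q + (1, 0)"
      have "(\<Sum>u\<leftarrow>q. w u) + (\<Sum>l<Suc a. D l) \<le>
          growth (Suc a + b) D (\<lambda>l i. w (antidiagonal (Suc a + b) l i))" for D
        using step[of D] by (simp add: max_def split: if_splits)
      then show ?thesis
        using v last by (intro exI[of _ "Suc a"] exI[of _ b]) simp
    next
      assume v: "v = last q + (0, 1)"
      have "(\<Sum>u\<leftarrow>q. w u) + (\<Sum>l<a. D l) \<le>
          growth (a + Suc b) D (\<lambda>l i. w (antidiagonal (a + Suc b) l i))" for D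
        using step[of D] by (simp add: max_def split: if_splits)
      then show ?thesis
        using v last by (intro exI[of _ a] exI[of _ "Suc b"]) simp
    qed
  qed
qed simp

lemma last_passage_le_growth:
  assumes "i \<le> n"
  shows "last_passage w (0, 0) (int i, int n - int i) + (\<Sum>l<i. D l) \<le>
    growth n D (\<lambda>l j. w (antidiagonal n l j))"
proof -
  have "last_passage w (0, 0) (int i, int n - int i) \<in>
      (\<lambda>p. \<Sum>v\<leftarrow>butlast p. w v) ` up_right_paths (0, 0) (int i, int n - int i)"
    unfolding last_passage_def
    using assms by (intro Max_in finite_imageI finite_up_right_paths) (simp add: up_right_paths_nonempty)
  then obtain p where p: "p \<in> up_right_paths (0, 0) (int i, int n - int i)"
    and eq: "last_passage w (0, 0) (int i, int n - int i) = (\<Sum>v\<leftarrow>butlast p. w v)" by blast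
  obtain a b where "last p = (int a, int b)"
    and le: "\<And>D. (\<Sum>v\<leftarrow>butlast p. w v) + (\<Sum>l<a. D l) \<le>
       growth (a + b) D (\<lambda>l i. w (antidiagonal (a + b) l i))"
    using p path_weight_le_growth[of p w] by (auto simp: up_right_paths_def)
  with p have "a = i" "a + b = n" by (auto simp: up_right_paths_def)
  with le[of D] eq show ?thesis by simp
qed

section \<open>An exponential bound for many end points at once\<close>

text \<open>If some passage time is at least \<open>x i\<close>, then
  the exponential moment of the growth given the weights is at least \<open>exp (\<theta> * x i)\<close> times that of a
  Laplace walk of length \<open>i\<close>, hence at least \<open>exp K\<close>; Markov's inequality concludes. For a single end
  point this is the classical Chernoff bound obtained from the stationary model; a set of end points
  costs nothing beyond the smallest exponent among them. The
  inclusion for \<open>E\<close> takes care of events that may fail to be measurable.\<close>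

lemma passage_time_tail:
  fixes X :: "int \<times> int \<Rightarrow> 'a \<Rightarrow> real" and x :: "nat \<Rightarrow> real"
  assumes "prob_space M"
    and indep: "prob_space.indep_vars M (\<lambda>_. borel) X UNIV"
    and exp: "\<And>v. distributed M lborel (X v) (\<lambda>s. ennreal (exponential_density 1 s))"
    and \<theta>: "0 < \<theta>" "\<theta> < w" "w < 1"
    and S: "S \<subseteq> {..n}"
    and K: "\<And>i. i \<in> S \<Longrightarrow> K \<le> \<theta> * x i + real i * ln (w / (w - \<theta>) * ((1 - w) / (1 - w + \<theta>)))"
    and E: "E \<subseteq> {\<omega> \<in> space M. \<exists>i\<in>S.
      x i \<le> last_passage (\<lambda>v. X v \<omega>) (0, 0) (int i, int n - int i)}"
  shows "measure M E \<le> (w / (w - \<theta>)) ^ n * exp (- K)"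
proof -
  interpret prob_space M by fact
  define \<phi> where "\<phi> = w / (w - \<theta>) * ((1 - w) / (1 - w + \<theta>))"
  have \<phi>: "0 < \<phi>" using \<theta> by (simp add: \<phi>_def)
  define Z where "Z R = (\<integral>\<^sup>+D. ennreal (exp (\<theta> * growth n D R)) \<partial>iid (laplace_law w))" for R
  define rows where "rows \<omega> l i = X (antidiagonal n l i) \<omega>" for \<omega> l i
  interpret D: prob_space "laplace_law w" using \<theta> by (intro prob_space_laplace_law) auto
  interpret DS: prob_space "iid (laplace_law w)" by (rule prob_space_iid) unfold_locales
  have [measurable]: "X v \<in> borel_measurable M" for v
    using distributed_measurable[OF exp] by simp
  have [measurable]: "rows \<in> M \<rightarrow>\<^sub>M iid (iid borel)"
    unfolding rows_def by (intro measurable_abs_UNIV) simp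
  have [measurable]: "Z \<in> borel_measurable (iid (iid borel))"
    unfolding Z_def by measurable
  have "(\<integral>\<^sup>+\<omega>. Z (rows \<omega>) \<partial>M) = (\<integral>\<^sup>+R. Z R \<partial>distr M (iid (iid borel)) rows)"
    by (simp add: nn_integral_distr)
  also have "distr M (iid (iid borel)) rows = iid (iid (exp_law 1))"
    unfolding rows_def using assms(1-3) by (rule distr_antidiagonals)
  also have "(\<integral>\<^sup>+R. Z R \<partial>iid (iid (exp_law 1))) = ennreal ((w / (w - \<theta>)) ^ n)"
    unfolding Z_def using \<theta> by (rule nn_integral_exp_growth)
  finally have mean: "(\<integral>\<^sup>+\<omega>. Z (rows \<omega>) \<partial>M) = ennreal ((w / (w - \<theta>)) ^ n)" .
  define G where "G = {\<omega> \<in> space M. 1 \<le> ennreal (exp (- K)) * Z (rows \<omega>)}"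
  have "E \<subseteq> G"
  proof
    fix \<omega> assume "\<omega> \<in> E"
    then obtain i where \<omega>: "\<omega> \<in> space M" and i: "i \<in> S"
      and xi: "x i \<le> last_passage (\<lambda>v. X v \<omega>) (0, 0) (int i, int n - int i)"
      using E by auto
    have "exp (\<theta> * x i) * exp (\<theta> * (\<Sum>l<i. D l)) \<le> exp (\<theta> * growth n D (rows \<omega>))" for D
    proof -
      have "i \<le> n" using i S by auto
      then have "x i + (\<Sum>l<i. D l) \<le> growth n D (rows \<omega>)"
        using last_passage_le_growth[of i n "\<lambda>v. X v \<omega>" D] xi unfolding rows_def by linarith
      then have "\<theta> * (x i + (\<Sum>l<i. D l)) \<le> \<theta> * growth n D (rows \<omega>)"
        using \<theta> by (intro mult_left_mono) auto
      then show ?thesis by (simp add: exp_add[symmetric] ring_distribs)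
    qed
    then have "(\<integral>\<^sup>+D. ennreal (exp (\<theta> * x i)) * ennreal (exp (\<theta> * (\<Sum>l<i. D l))) \<partial>iid (laplace_law w))
        \<le> Z (rows \<omega>)"
      unfolding Z_def by (intro nn_integral_mono) (simp add: ennreal_mult[symmetric])
    also have "(\<integral>\<^sup>+D. ennreal (exp (\<theta> * x i)) * ennreal (exp (\<theta> * (\<Sum>l<i. D l))) \<partial>iid (laplace_law w)) =
        ennreal (exp (\<theta> * x i)) * ennreal (\<phi> ^ i)"
      using \<theta> by (subst nn_integral_cmult) (auto simp: nn_integral_laplace_walk_mgf \<phi>_def)
    also have "\<dots> = ennreal (exp (\<theta> * x i + real i * ln \<phi>))"
      using \<phi> by (simp add: ennreal_mult[symmetric] exp_add ln_realpow[symmetric])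
    finally have "ennreal (exp K) \<le> Z (rows \<omega>)"
      using K[OF i] by (simp add: \<phi>_def) (meson ennreal_leI exp_le_cancel_iff order_trans)
    then have "ennreal (exp (- K)) * ennreal (exp K) \<le> ennreal (exp (- K)) * Z (rows \<omega>)"
      by (intro mult_left_mono) auto
    then show "\<omega> \<in> G"
      using \<omega> by (simp add: G_def ennreal_mult[symmetric] exp_add[symmetric])
  qed
  have "emeasure M G \<le> ennreal (exp (- K)) * (\<integral>\<^sup>+\<omega>. Z (rows \<omega>) * indicator (space M) \<omega> \<partial>M)"
    unfolding G_def by (intro nn_integral_Markov_inequality) measurable
  also have "(\<integral>\<^sup>+\<omega>. Z (rows \<omega>) * indicator (space M) \<omega> \<partial>M) = (\<integral>\<^sup>+\<omega>. Z (rows \<omega>) \<partial>M)"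
    by (intro nn_integral_cong) simp
  also have "ennreal (exp (- K)) * \<dots> = ennreal ((w / (w - \<theta>)) ^ n * exp (- K))"
    using \<theta> by (simp add: mean ennreal_mult[symmetric] mult.commute)
  finally have "measure M G \<le> (w / (w - \<theta>)) ^ n * exp (- K)"
    using \<theta> by (simp add: emeasure_eq_measure)
  moreover have "measure M E \<le> measure M G"
  proof (cases "E \<in> sets M")
    case True
    have "G \<in> sets M" unfolding G_def by measurable
    then show ?thesis using \<open>E \<subseteq> G\<close> by (intro finite_measure_mono)
  qed (simp add: measure_notin_sets)
  ultimately show ?thesis by linarith
qed

section \<open>Expansion of the exponent\<close>

lemma ln_ratio_le:
  fixes z :: real
  assumes "0 \<le> z" "z \<le> 1 / 2"
  shows "ln ((1 + z) / (1 - z)) \<le> 2 * z + 2 / 3 * z ^ 3 + z ^ 5"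
proof -
  define f where "f z = 2 * z + 2 / 3 * z ^ 3 + z ^ 5 - (ln (1 + z) - ln (1 - z))" for z :: real
  have "f 0 \<le> f z"
  proof (rule DERIV_nonneg_imp_nondecreasing[OF assms(1)])
    fix x :: real assume x: "0 \<le> x" "x \<le> z"
    then have x': "x \<le> 1 / 2" using assms by simp
    have "(f has_real_derivative 2 + 2 * x ^ 2 + 5 * x ^ 4 - (1 / (1 + x) + 1 / (1 - x))) (at x)"
      unfolding f_def using x x'
      by (auto intro!: derivative_eq_intros)
    moreover have "1 / (1 + x) + 1 / (1 - x) \<le> 2 + 2 * x ^ 2 + 5 * x ^ 4"
    proof -
      have "x ^ 2 \<le> (1 / 2) ^ 2" using x x' by (intro power_mono) auto
      then have x2: "5 * x ^ 2 \<le> 3" by (simp add: power2_eq_square)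
      have "1 / (1 + x) + 1 / (1 - x) = 2 / (1 - x ^ 2)"
        using x x' by (simp add: field_simps power2_eq_square)
      also have "\<dots> \<le> 2 + 2 * x ^ 2 + 5 * x ^ 4"
      proof -
        have "0 \<le> x ^ 4 * (3 - 5 * x ^ 2)" using x2 by simp
        also have "\<dots> = (2 + 2 * x ^ 2 + 5 * x ^ 4) * (1 - x ^ 2) - 2" by algebra
        finally show ?thesis using x2 by (simp add: divide_le_eq)
      qed
      finally show ?thesis .
    qed
    ultimately show "\<exists>y. (f has_real_derivative y) (at x) \<and> 0 \<le> y" by force
  qed
  then show ?thesis using assms by (simp add: f_def ln_div)
qed

text \<open>The end point is \<open>(N - k, N + k)\<close>, and \<open>y\<close> is the tilt of the boundary. The linear terms in \<open>s\<close>
  add up to \<open>4 * s * (N - k * y) / (1 - y\<^sup>2)\<close>. To second order in \<open>y\<close> this is the typical passage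
  time \<open>4 * N - k\<^sup>2 / N\<close>, times \<open>s\<close>, plus a square that vanishes at \<open>k = 2 * N * y\<close>, the direction
  for which the boundary is tuned. With \<open>s\<close> and \<open>y\<close> of order \<open>N powr (- 1 / 3)\<close> and \<open>k\<close> of order
  \<open>N powr (2 / 3)\<close>, the terms in parentheses tend to \<open>0\<close>.\<close>

lemma chernoff_exponent_le:
  fixes N k y s :: real
  assumes N: "0 < N" and s: "0 < s" "s \<le> 1 / 8" and y: "\<bar>y\<bar> \<le> 1 / 4" and k: "\<bar>k\<bar> \<le> N"
  shows "(N + k) * ln ((1 + y + s) / (1 + y - s)) + (N - k) * ln ((1 - y + s) / (1 - y - s)) \<le>
    4 * s * N - s * k\<^sup>2 / N + s * (k - 2 * N * y)\<^sup>2 / N + 4 / 3 * N * s ^ 3 +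
    (56 / 3 * N * s ^ 3 * \<bar>y\<bar> + 64 * N * s ^ 5 + 4 * s * \<bar>k\<bar> * \<bar>y\<bar> ^ 3 + 16 * s * N * y ^ 4)"
proof -
  \<comment> \<open>The factor \<open>1 + x\<close> exceeds \<open>1 / 2\<close>, hence \<open>32 = 2 ^ 5\<close>. In the cubic term its inverse cube must be
    controlled to first order in \<open>y\<close>, because \<open>N * s ^ 3\<close> stays of order \<open>1\<close>.\<close>
  have ln_le: "ln ((1 + x + s) / (1 + x - s)) \<le>
      2 * s / (1 + x) + 2 / 3 * s ^ 3 * (1 + 14 * \<bar>y\<bar>) + 32 * s ^ 5"
    if x: "x = y \<or> x = - y" for x
  proof -
    define u where "u = 1 + x"
    define a where "a = \<bar>y\<bar>"
    have a: "0 \<le> a" "a \<le> 1 / 4" using y by (auto simp: a_def)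
    have u: "1 - a \<le> u" using x by (auto simp: u_def a_def)
    then have u': "3 / 4 \<le> u" using a by simp
    have ratio: "(1 + x + s) / (1 + x - s) = (1 + s / u) / (1 - s / u)"
    proof -
      have "1 + s / u = (1 + x + s) / u" "1 - s / u = (1 + x - s) / u"
        using u' by (simp_all add: u_def field_simps)
      then show ?thesis using u' by simp
    qed
    have "ln ((1 + s / u) / (1 - s / u)) \<le> 2 * (s / u) + 2 / 3 * (s / u) ^ 3 + (s / u) ^ 5"
      using u' s by (intro ln_ratio_le) (auto simp: field_simps)
    moreover have "(s / u) ^ 3 \<le> s ^ 3 * (1 + 14 * a)"
    proof -
      have "39 * a \<le> 11" "14 * a ^ 3 \<le> 41 * a ^ 2"
      proof -
        have "a ^ 2 * (14 * a) \<le> a ^ 2 * 41" using a by (intro mult_left_mono) auto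
        then show "14 * a ^ 3 \<le> 41 * a ^ 2" by (simp add: power2_eq_square power3_eq_cube)
      qed (use a in simp)
      then have "0 \<le> a * (11 - 39 * a + 41 * a ^ 2 - 14 * a ^ 3)"
        using a by (intro mult_nonneg_nonneg) auto
      also have "\<dots> = (1 + 14 * a) * (1 - a) ^ 3 - 1" by algebra
      also have "\<dots> \<le> (1 + 14 * a) * u ^ 3 - 1"
        using u a by (intro diff_right_mono mult_left_mono power_mono) auto
      finally have "s ^ 3 * 1 \<le> s ^ 3 * ((1 + 14 * a) * u ^ 3)"
        using s by (intro mult_left_mono) auto
      then show ?thesis using u' by (simp add: power_divide divide_le_eq mult.assoc)
    qed
    moreover have "(s / u) ^ 5 \<le> 32 * s ^ 5"
    proof -
      have "(s / u) ^ 5 \<le> (2 * s) ^ 5"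
        using u' s by (intro power_mono) (auto simp: divide_le_eq)
      then show ?thesis by (simp add: power_mult_distrib)
    qed
    ultimately show ?thesis unfolding ratio by (simp add: u_def a_def)
  qed
  have sq: "y ^ 2 \<le> 1 / 2"
  proof -
    have "\<bar>y\<bar> ^ 2 \<le> (1 / 4) ^ 2" using y by (intro power_mono) auto
    then show ?thesis by (simp add: power2_eq_square)
  qed
  have yk: "\<bar>k * y\<bar> \<le> N"
  proof -
    have "\<bar>k\<bar> * \<bar>y\<bar> \<le> N * 1" using y k N by (intro mult_mono) auto
    then show ?thesis by (simp add: abs_mult)
  qed
  define A where "A = 2 / 3 * s ^ 3 * (1 + 14 * \<bar>y\<bar>) + 32 * s ^ 5"
  have "(N + k) * ln ((1 + y + s) / (1 + y - s)) \<le> (N + k) * (2 * s / (1 + y) + A)"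
    using ln_le[of y] k unfolding A_def by (intro mult_left_mono) auto
  moreover have "(N - k) * ln ((1 - y + s) / (1 - y - s)) \<le> (N - k) * (2 * s / (1 - y) + A)"
    using ln_le[of "- y"] k unfolding A_def by (intro mult_left_mono) auto
  moreover have "(N + k) * (2 * s / (1 + y) + A) + (N - k) * (2 * s / (1 - y) + A) =
      4 * s * ((N - k * y) * (1 / (1 - y ^ 2))) + 2 * N * A"
  proof -
    have y1: "1 + y \<noteq> 0" "1 - y \<noteq> 0" using y by auto
    have "1 - y ^ 2 = (1 + y) * (1 - y)" by algebra
    then show ?thesis using y1 by (simp add: divide_simps) (simp add: algebra_simps)
  qed
  moreover have "4 * s * ((N - k * y) * (1 / (1 - y ^ 2))) \<le>
      4 * s * ((N - k * y) * (1 + y ^ 2 + 2 * y ^ 4))"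
  proof -
    have "0 \<le> y ^ 4 * (1 - 2 * y ^ 2)" using sq by simp
    also have "\<dots> = (1 + y ^ 2 + 2 * y ^ 4) * (1 - y ^ 2) - 1" by algebra
    finally have "1 / (1 - y ^ 2) \<le> 1 + y ^ 2 + 2 * y ^ 4"
      using sq by (simp add: divide_le_eq)
    then show ?thesis using s yk by (intro mult_left_mono) auto
  qed
  moreover have "4 * s * ((N - k * y) * (1 + y ^ 2 + 2 * y ^ 4)) =
      4 * s * N - s * k\<^sup>2 / N + s * (k - 2 * N * y)\<^sup>2 / N +
      4 * s * (- k * y ^ 3) + 8 * s * (N - k * y) * y ^ 4"
    using N by (simp add: field_simps power2_eq_square) algebra
  moreover have "4 * s * (- k * y ^ 3) \<le> 4 * s * \<bar>k\<bar> * \<bar>y\<bar> ^ 3"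
  proof -
    have "- k * y ^ 3 \<le> \<bar>k * y ^ 3\<bar>" by simp
    then have "4 * s * (- k * y ^ 3) \<le> 4 * s * (\<bar>k\<bar> * \<bar>y\<bar> ^ 3)"
      using s by (intro mult_left_mono) (auto simp: abs_mult power_abs)
    then show ?thesis by (simp only: mult.assoc)
  qed
  moreover have "8 * s * (N - k * y) * y ^ 4 \<le> 16 * s * N * y ^ 4"
  proof -
    have "8 * s * (N - k * y) * y ^ 4 \<le> 8 * s * (2 * N) * y ^ 4"
      using s yk by (intro mult_right_mono mult_left_mono) auto
    then show ?thesis by simp
  qed
  moreover have "2 * N * A = 4 / 3 * N * s ^ 3 + 56 / 3 * N * s ^ 3 * \<bar>y\<bar> + 64 * N * s ^ 5"
    by (simp add: A_def algebra_simps)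
  ultimately show ?thesis by linarith
qed

section \<open>Tail bound over a segment\<close>

lemma floor_dist_of_mem_I_seg:
  assumes "real_pt (u_pt N x) \<in> I_seg N m \<delta>" "0 \<le> \<delta>"
  shows "\<bar>real_of_int \<lfloor>x * (2 * real N) powr (2 / 3)\<rfloor> - real_of_int \<lfloor>m * (2 * real N) powr (2 / 3)\<rfloor>\<bar> \<le>
    real_of_int \<lfloor>\<delta> * (2 * real N) powr (2 / 3)\<rfloor> / 2"
proof -
  define h where "h = real_of_int \<lfloor>\<delta> * (2 * real N) powr (2 / 3)\<rfloor> / 2"
  have h: "0 \<le> h" using assms(2) by (simp add: h_def)
  from assms(1) obtain u where u: "0 \<le> u" "u \<le> 1"
    and "real_pt (u_pt N x) = (1 - u) *\<^sub>R (real_pt (u_pt N m) - h *\<^sub>R (1, -1)) +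
      u *\<^sub>R (real_pt (u_pt N m) + h *\<^sub>R (1, -1))"
    by (auto simp: I_seg_def Let_def h_def closed_segment_def)
  from arg_cong[OF this(3), of fst]
  have "fst (real_pt (u_pt N m)) - fst (real_pt (u_pt N x)) = h * (1 - 2 * u)"
    by (simp add: algebra_simps)
  moreover have "\<bar>h * (1 - 2 * u)\<bar> \<le> h * 1"
    unfolding abs_mult using u h by (intro mult_mono) auto
  ultimately show ?thesis
    by (simp add: real_pt_def u_pt_def h_def[symmetric])
qed

lemma midpoint_mem_I_seg: "real_pt (u_pt N m) \<in> I_seg N m \<delta>"
  unfolding I_seg_def Let_def closed_segment_def
  by (auto intro!: exI[of _ "1 / 2"] simp: algebra_simps scaleR_add_left[symmetric])

text \<open>A real supremum of an unbounded set is unspecified, but a lower bound on it always yields a nearly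
  extremal element, because an upper bound of a nonempty set bounds its supremum.\<close>

lemma exists_of_le_SUP:
  fixes f :: "'b \<Rightarrow> real"
  assumes "A \<noteq> {}" "c \<le> (SUP x\<in>A. f x)"
  shows "\<exists>x\<in>A. c - 1 < f x"
proof (rule ccontr)
  assume "\<not> ?thesis"
  then have "(SUP x\<in>A. f x) \<le> c - 1" using assms(1) by (intro cSUP_least) auto
  with assms(2) show False by simp
qed

text \<open>The left-hand side is \<open>2 * s\<close> plus the error terms of \<open>chernoff_exponent_le\<close> for \<open>N = r ^ 3\<close> and
  \<open>s = \<sigma> / r\<close>. Every term is of order \<open>1 / r\<close> or \<open>1 / r\<^sup>2\<close>, and the lower bound on \<open>r\<close> adds up the
  coefficients.\<close>

lemma chernoff_error_le_one:
  fixes r \<sigma> C k y :: real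
  assumes r: "1 \<le> r" "2 * \<sigma> + 10 * \<sigma> ^ 3 * C + 64 * \<sigma> ^ 5 + 2 * \<sigma> * C ^ 4 \<le> r"
    and \<sigma>: "0 \<le> \<sigma>" and C: "0 \<le> C"
    and k: "\<bar>k\<bar> \<le> C * r\<^sup>2" and y: "\<bar>y\<bar> \<le> C / (2 * r)"
  shows "2 * (\<sigma> / r) + (56 / 3 * r ^ 3 * (\<sigma> / r) ^ 3 * \<bar>y\<bar> + 64 * r ^ 3 * (\<sigma> / r) ^ 5 +
    4 * (\<sigma> / r) * \<bar>k\<bar> * \<bar>y\<bar> ^ 3 + 16 * (\<sigma> / r) * r ^ 3 * y ^ 4) \<le> 1"
proof -
  have r0: "0 < r" using r by simp
  have inv2: "1 / r ^ 2 \<le> 1 / r"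
    using r by (simp add: divide_simps power2_eq_square)
  have "56 / 3 * r ^ 3 * (\<sigma> / r) ^ 3 * \<bar>y\<bar> \<le> 56 / 3 * r ^ 3 * (\<sigma> / r) ^ 3 * (C / (2 * r))"
    using y \<sigma> r0 by (intro mult_left_mono) auto
  also have "\<dots> = 28 / 3 * (\<sigma> ^ 3 * C / r)"
    using r0 by (simp add: field_simps power3_eq_cube)
  also have "\<dots> \<le> 10 * (\<sigma> ^ 3 * C / r)"
    using \<sigma> C r0 by (intro mult_right_mono) auto
  finally have 1: "56 / 3 * r ^ 3 * (\<sigma> / r) ^ 3 * \<bar>y\<bar> \<le> 10 * \<sigma> ^ 3 * C / r" by simp
  have "64 * r ^ 3 * (\<sigma> / r) ^ 5 = 64 * \<sigma> ^ 5 * (1 / r ^ 2)"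
    using r0 by (simp add: field_simps eval_nat_numeral)
  also have "\<dots> \<le> 64 * \<sigma> ^ 5 * (1 / r)"
    using inv2 \<sigma> by (intro mult_left_mono) auto
  finally have 2: "64 * r ^ 3 * (\<sigma> / r) ^ 5 \<le> 64 * \<sigma> ^ 5 / r" by simp
  have y3: "\<bar>y\<bar> ^ n \<le> (C / (2 * r)) ^ n" for n
    using y by (intro power_mono) auto
  have "4 * (\<sigma> / r) * \<bar>k\<bar> * \<bar>y\<bar> ^ 3 \<le> 4 * (\<sigma> / r) * (C * r\<^sup>2) * (C / (2 * r)) ^ 3"
    using k y3 \<sigma> r0 C by (intro mult_mono mult_left_mono) auto
  also have "\<dots> = \<sigma> * C ^ 4 / 2 * (1 / r ^ 2)"
    using r0 by (simp add: field_simps eval_nat_numeral)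
  also have "\<dots> \<le> \<sigma> * C ^ 4 * (1 / r)"
    using inv2 \<sigma> C r0 by (intro mult_mono) auto
  finally have 3: "4 * (\<sigma> / r) * \<bar>k\<bar> * \<bar>y\<bar> ^ 3 \<le> \<sigma> * C ^ 4 / r" by simp
  have "16 * (\<sigma> / r) * r ^ 3 * y ^ 4 \<le> 16 * (\<sigma> / r) * r ^ 3 * (C / (2 * r)) ^ 4"
    using y3[of 4] \<sigma> r0 by (intro mult_left_mono) auto
  also have "\<dots> = \<sigma> * C ^ 4 * (1 / r ^ 2)"
    using r0 by (simp add: field_simps eval_nat_numeral)
  also have "\<dots> \<le> \<sigma> * C ^ 4 * (1 / r)"
    using inv2 \<sigma> C by (intro mult_left_mono) auto
  finally have 4: "16 * (\<sigma> / r) * r ^ 3 * y ^ 4 \<le> \<sigma> * C ^ 4 / r" by simp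
  have "(2 * \<sigma> + 10 * \<sigma> ^ 3 * C + 64 * \<sigma> ^ 5 + 2 * \<sigma> * C ^ 4) / r \<le> 1"
    using r r0 by (simp add: divide_le_eq)
  moreover have "(2 * \<sigma> + 10 * \<sigma> ^ 3 * C + 64 * \<sigma> ^ 5 + 2 * \<sigma> * C ^ 4) / r =
      2 * (\<sigma> / r) + (10 * \<sigma> ^ 3 * C / r + 64 * \<sigma> ^ 5 / r + \<sigma> * C ^ 4 / r + \<sigma> * C ^ 4 / r)"
    by (simp add: add_divide_distrib)
  ultimately show ?thesis using 1 2 3 4 by linarith
qed

text \<open>Here \<open>r\<close> is the fluctuation scale, so \<open>N = r ^ 3\<close>, and the exponential parameter is \<open>s = \<sigma> / r\<close>.
  With the level \<open>\<tau> = 2 powr (4 / 3) * r * t\<close>, the exponent is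
  \<open>- s * \<tau> + 4 / 3 * N * s ^ 3 = - 2 powr (4 / 3) * \<sigma> * t + 4 / 3 * \<sigma> ^ 3\<close> up to smaller terms; it is
  smallest at the stated \<open>\<sigma>\<close>, with value \<open>- 4 / 3 * t * sqrt t\<close>. The boundary is tuned to the midpoint
  of the segment, and an end point at distance at most \<open>1 / 2\<close>, in units of
  \<open>(2 * N) powr (2 / 3)\<close>, costs at most \<open>sqrt t / 2\<close>, which is of lower order. The constant \<open>C\<close> bounds the position of the end point in
  units of \<open>r\<^sup>2\<close>.\<close>

lemma segment_tail:
  fixes M :: "'a measure" and X :: "int \<times> int \<Rightarrow> 'a \<Rightarrow> real"
  assumes prob: "prob_space M" "prob_space.indep_vars M (\<lambda>_. borel) X UNIV"
      "\<And>v. distributed M lborel (X v) (\<lambda>s. ennreal (exponential_density 1 s))"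
    and t: "1 \<le> t" and m: "0 \<le> m" "m \<le> m0"
    and r: "r = real N powr (1 / 3)" and \<sigma>: "\<sigma> = 2 powr (- 1 / 3) * sqrt t" and C: "C = 2 * (m0 + 1)"
    and large: "2 * C + 1 \<le> r" "8 * \<sigma> \<le> r"
      "2 * \<sigma> + 10 * \<sigma> ^ 3 * C + 64 * \<sigma> ^ 5 + 2 * \<sigma> * C ^ 4 \<le> r"
    and Q: "Q \<le> 4 / 3 * (t * sqrt t) - sqrt t / 2 - 1"
  shows "measure M {\<omega> \<in> space M.
      (SUP x\<in>{x. real_pt (u_pt N x) \<in> I_seg N m 1}.
         T_val (\<lambda>v. X v \<omega>) N x - 4 * real N + 2 powr (4 / 3) * real N powr (1 / 3) * x\<^sup>2)
      \<ge> 2 powr (4 / 3) * real N powr (1 / 3) * t} \<le> exp (- Q)"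
proof -
  interpret prob_space M by (rule prob)
  have C1: "2 \<le> C" using m by (simp add: C)
  have r1: "5 \<le> r" using large C1 by simp
  have N: "real N = r ^ 3" unfolding r by (cases "N = 0") (simp_all add: powr_power)
  define L where "L = (2 * real N) powr (2 / 3)"
  \<comment> \<open>All powers of \<open>2\<close> with exponent a multiple of \<open>1 / 3\<close> are written as powers of \<open>g\<close>.\<close>
  define g where "g = (2::real) powr (1 / 3)"
  have g: "0 < g" "g ^ 3 = 2" by (auto simp: g_def powr_power)
  have pow43: "2 powr (4 / 3) = g ^ 4" and \<sigma>_g: "\<sigma> * g = sqrt t"
    unfolding g_def \<sigma> by (simp_all add: powr_power powr_minus field_simps)
  have g2: "g ^ 2 \<le> 2"
  proof (rule ccontr)
    assume "\<not> ?thesis"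
    then have "2 ^ 3 < (g ^ 2) ^ 3" by (intro power_strict_mono) auto
    also have "(g ^ 2) ^ 3 = (g ^ 3) ^ 2" by algebra
    finally show False by (simp add: g)
  qed
  have L: "L = g ^ 2 * r ^ 2"
    unfolding L_def g_def r by (cases "N = 0") (simp_all add: powr_mult powr_power)
  have Lpos: "0 < L" using g r1 by (simp add: L)
  have Lle: "L \<le> 2 * r ^ 2" unfolding L using g2 by (intro mult_right_mono) auto
  have \<sigma>0: "0 < \<sigma>" using t by (simp add: \<sigma>)
  have \<sigma>2: "2 * \<sigma> ^ 2 = g * t"
  proof -
    have "g ^ 2 * \<sigma> ^ 2 = t" using \<sigma>_g t by (simp add: power_mult_distrib[symmetric] mult.commute)
    moreover have "g ^ 3 * \<sigma> ^ 2 = g * (g ^ 2 * \<sigma> ^ 2)" by algebra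
    ultimately show ?thesis by (simp add: g)
  qed
  define s where "s = \<sigma> / r"
  define k0 where "k0 = real_of_int \<lfloor>m * L\<rfloor>"
  define y where "y = k0 / (2 * real N)"
  define \<tau> where "\<tau> = 2 powr (4 / 3) * r * t"
  define w where "w = (1 + y + s) / 2"
  define A where "A = ln ((1 + y + s) / (1 + y - s))"
  define B where "B = ln ((1 - y + s) / (1 - y - s))"
  define S where "S = {i. i \<le> 2 * N \<and> \<bar>(real N - real i) - k0\<bar> \<le> L / 2 \<and>
      \<bar>real N - real i\<bar> \<le> C * r\<^sup>2}"
  \<comment> \<open>The \<open>2\<close> absorbs the error of the supremum and that of rounding \<open>x * L\<close> to an integer, each at
    most \<open>1\<close>.\<close>
  define lev where "lev i = 4 * real N - (real N - real i)\<^sup>2 / real N + \<tau> - 2" for i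
  have Npos: "0 < real N" using N r1 by simp
  have k0: "\<bar>k0\<bar> \<le> m0 * L"
  proof -
    have "0 \<le> k0" "k0 \<le> m * L" using m Lpos by (auto simp: k0_def)
    moreover have "m * L \<le> m0 * L" using m Lpos by (intro mult_right_mono) auto
    ultimately show ?thesis by simp
  qed
  have CL: "(m0 + 1) * L \<le> C * r\<^sup>2"
    using mult_left_mono[OF Lle, of "m0 + 1"] m by (simp add: C algebra_simps)
  have y_le: "\<bar>y\<bar> \<le> C / (2 * r)"
  proof -
    have "\<bar>k0\<bar> \<le> C * r\<^sup>2" using k0 CL Lpos by (simp add: algebra_simps)
    then have "\<bar>y\<bar> \<le> C * r\<^sup>2 / (2 * r ^ 3)"
      using r1 by (simp add: y_def N divide_right_mono)
    also have "\<dots> = C / (2 * r)" using r1 by (simp add: field_simps power2_eq_square power3_eq_cube)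
    finally show ?thesis .
  qed
  have y4: "\<bar>y\<bar> \<le> 1 / 4"
  proof -
    have "C / (2 * r) \<le> 1 / 4" using large r1 C1 by (simp add: field_simps)
    then show ?thesis using y_le by simp
  qed
  have s: "0 < s" "s \<le> 1 / 8" using \<sigma>0 large r1 by (auto simp: s_def field_simps)
  have w: "s < w" "w < 1" using s y4 by (auto simp: w_def)
  have wA: "w / (w - s) = (1 + y + s) / (1 + y - s)"
    and wB: "(1 - w) / (1 - w + s) = (1 - y - s) / (1 - y + s)"
    using s y4 by (auto simp: w_def field_simps)
  have ln_phi: "ln (w / (w - s) * ((1 - w) / (1 - w + s))) = A - B"
  proof -
    have "0 < 1 + y + s" "0 < 1 + y - s" "0 < 1 - y - s" "0 < 1 - y + s"
      using s y4 by linarith+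
    then show ?thesis unfolding wA wB A_def B_def by (simp add: ln_mult ln_div)
  qed
  have exponent: "Q + 2 * real N * A \<le> s * lev i + real i * (A - B)" if "i \<in> S" for i
  proof -
    define k where "k = real N - real i"
    have k: "\<bar>k - k0\<bar> \<le> L / 2" "\<bar>k\<bar> \<le> C * r\<^sup>2" using that by (auto simp: S_def k_def)
    have "C * r\<^sup>2 \<le> r * r\<^sup>2" using large C1 by (intro mult_right_mono) auto
    then have kN: "\<bar>k\<bar> \<le> real N" using k by (simp add: N power2_eq_square power3_eq_cube)
    have tilt: "(real N + k) * A + (real N - k) * B \<le>
        4 * s * real N - s * k\<^sup>2 / real N + s * (k - k0)\<^sup>2 / real N + 4 / 3 * real N * s ^ 3 +
        (56 / 3 * real N * s ^ 3 * \<bar>y\<bar> + 64 * real N * s ^ 5 + 4 * s * \<bar>k\<bar> * \<bar>y\<bar> ^ 3 +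
         16 * s * real N * y ^ 4)"
      using chernoff_exponent_le[OF Npos s y4 kN] Npos unfolding A_def B_def y_def by simp
    have err: "2 * s + (56 / 3 * real N * s ^ 3 * \<bar>y\<bar> + 64 * real N * s ^ 5 +
        4 * s * \<bar>k\<bar> * \<bar>y\<bar> ^ 3 + 16 * s * real N * y ^ 4) \<le> 1"
      unfolding N s_def using r1 large \<sigma>0 C1 k y_le by (intro chernoff_error_le_one[of _ _ C]) auto
    have "(k - k0)\<^sup>2 \<le> (L / 2)\<^sup>2"
      using power_mono[OF k(1), of 2] by simp
    then have "s * (k - k0)\<^sup>2 / real N \<le> s * (L / 2)\<^sup>2 / real N"
      using s Npos by (intro divide_right_mono mult_left_mono) auto
    also have "\<dots> = \<sigma> * g * g ^ 3 / 4"
      using r1 by (simp add: s_def N L field_simps eval_nat_numeral)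
    also have "\<dots> = sqrt t / 2" unfolding \<sigma>_g g by simp
    finally have window: "s * (k - k0)\<^sup>2 / real N \<le> sqrt t / 2" .
    have "real N * s ^ 3 = \<sigma> ^ 3" using r1 by (simp add: N s_def power_divide)
    also have "\<dots> = \<sigma> * (2 * \<sigma> ^ 2) / 2" by (simp add: power2_eq_square power3_eq_cube)
    also have "\<dots> = t * (\<sigma> * g) / 2" unfolding \<sigma>2 by simp
    finally have cubic: "real N * s ^ 3 = t * sqrt t / 2" unfolding \<sigma>_g .
    have "s * \<tau> = \<sigma> * g * g ^ 3 * t" using r1 by (simp add: s_def \<tau>_def pow43 eval_nat_numeral)
    then have linear: "s * \<tau> = 2 * (t * sqrt t)" unfolding \<sigma>_g g by simp
    have "s * lev i = 4 * s * real N - s * k\<^sup>2 / real N + s * \<tau> - 2 * s"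
      by (simp add: lev_def k_def algebra_simps)
    moreover have "real i * (A - B) = 2 * real N * A - ((real N + k) * A + (real N - k) * B)"
      by (simp add: k_def algebra_simps)
    ultimately show ?thesis
      using tilt err window cubic linear Q by linarith
  qed
  \<comment> \<open>The parabola in the scaled variable \<open>x\<close> is the parabola \<open>k\<^sup>2 / N\<close> in lattice units.\<close>
  have L2: "2 powr (4 / 3) * r * x\<^sup>2 = (x * L)\<^sup>2 / real N" for x
    using r1 by (simp add: pow43 N L field_simps eval_nat_numeral)
  have reach: "\<exists>i\<in>S. lev i \<le> last_passage v (0, 0) (int i, int (2 * N) - int i)"
    if x: "real_pt (u_pt N x) \<in> I_seg N m 1"
      and high: "\<tau> - 1 < T_val v N x - 4 * real N + 2 powr (4 / 3) * r * x\<^sup>2" for x v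
  proof -
    define k where "k = \<lfloor>x * L\<rfloor>"
    have near: "\<bar>real_of_int k - k0\<bar> \<le> L / 2"
    proof -
      have "\<bar>real_of_int k - k0\<bar> \<le> real_of_int \<lfloor>L\<rfloor> / 2"
        using floor_dist_of_mem_I_seg[OF x] by (simp add: k_def k0_def L_def)
      then show ?thesis by linarith
    qed
    moreover have "m0 * L + L \<le> C * r\<^sup>2" using CL by (simp add: distrib_right)
    ultimately have k_le: "\<bar>real_of_int k\<bar> \<le> C * r\<^sup>2"
      using k0 Lpos by linarith
    have "C * r\<^sup>2 \<le> r * r\<^sup>2" using large C1 by (intro mult_right_mono) auto
    then have "\<bar>real_of_int k\<bar> \<le> real N" using k_le by (simp add: N power2_eq_square power3_eq_cube)
    then have kN: "\<bar>k\<bar> \<le> int N" by linarith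
    define i where "i = nat (int N - k)"
    have i: "int i = int N - k" using kN by (simp add: i_def)
    then have ri: "real N - real i = real_of_int k" by linarith
    have "i \<in> S" using near k_le kN i by (simp add: S_def ri)
    have u: "u_pt N x = (int i, int (2 * N) - int i)"
      using i by (simp add: u_pt_def k_def L_def)
    have "(x * L)\<^sup>2 \<le> (real_of_int k)\<^sup>2 + (2 * \<bar>real_of_int k\<bar> + 1)"
    proof -
      define e where "e = x * L - real_of_int k"
      have e: "0 \<le> e" "e \<le> 1" unfolding e_def k_def by linarith+
      have "e * e \<le> 1 * 1" using e by (intro mult_mono) auto
      moreover have "real_of_int k * e \<le> \<bar>real_of_int k\<bar> * 1"
        using e by (intro mult_mono) auto
      moreover have "(x * L)\<^sup>2 = (real_of_int k)\<^sup>2 + 2 * (real_of_int k * e) + e * e"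
        by (simp add: e_def power2_eq_square algebra_simps)
      ultimately show ?thesis by simp
    qed
    also have "2 * \<bar>real_of_int k\<bar> + 1 \<le> real N"
    proof -
      have "1 \<le> r\<^sup>2" using r1 by simp
      then have "2 * \<bar>real_of_int k\<bar> + 1 \<le> (2 * C + 1) * r\<^sup>2" using k_le by (simp add: algebra_simps)
      also have "\<dots> \<le> r * r\<^sup>2" using large by (intro mult_right_mono) auto
      finally show ?thesis by (simp add: N power2_eq_square power3_eq_cube)
    qed
    finally have "(x * L)\<^sup>2 / real N \<le> (real_of_int k)\<^sup>2 / real N + 1"
      using Npos by (simp add: field_simps)
    then have "lev i \<le> last_passage v (0, 0) (int i, int (2 * N) - int i)"
      using high unfolding L2 T_val_def u lev_def ri by linarith
    with \<open>i \<in> S\<close> show ?thesis by blast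
  qed
  let ?seg = "{x. real_pt (u_pt N x) \<in> I_seg N m 1}"
  let ?f = "\<lambda>\<omega> x. T_val (\<lambda>v. X v \<omega>) N x - 4 * real N + 2 powr (4 / 3) * r * x\<^sup>2"
  let ?E = "{\<omega> \<in> space M. (SUP x\<in>?seg. ?f \<omega> x) \<ge> \<tau>}"
  have "?E \<subseteq> {\<omega> \<in> space M. \<exists>i\<in>S.
      lev i \<le> last_passage (\<lambda>v. X v \<omega>) (0, 0) (int i, int (2 * N) - int i)}"
  proof
    fix \<omega> assume "\<omega> \<in> ?E"
    then have \<omega>: "\<omega> \<in> space M" and "\<tau> \<le> (SUP x\<in>?seg. ?f \<omega> x)" by auto
    moreover have "?seg \<noteq> {}" using midpoint_mem_I_seg by blast
    ultimately obtain x where "x \<in> ?seg" "\<tau> - 1 < ?f \<omega> x"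
      using exists_of_le_SUP[of ?seg \<tau> "?f \<omega>"] by blast
    with \<omega> reach show "\<omega> \<in> {\<omega> \<in> space M. \<exists>i\<in>S.
        lev i \<le> last_passage (\<lambda>v. X v \<omega>) (0, 0) (int i, int (2 * N) - int i)}" by simp
  qed
  then have "measure M ?E \<le> (w / (w - s)) ^ (2 * N) * exp (- (Q + 2 * real N * A))"
  proof (rule passage_time_tail[OF prob s(1) w, rotated 2])
    show "S \<subseteq> {..2 * N}" by (auto simp: S_def)
    show "Q + 2 * real N * A \<le> s * lev i + real i * ln (w / (w - s) * ((1 - w) / (1 - w + s)))"
      if "i \<in> S" for i
      unfolding ln_phi using that by (rule exponent)
  qed
  also have "(w / (w - s)) ^ (2 * N) = exp (2 * real N * A)"
  proof -
    have "0 < w / (w - s)" using s w by simp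
    then have "w / (w - s) = exp A" unfolding A_def wA[symmetric] by simp
    then show ?thesis by (simp add: exp_of_nat_mult[symmetric])
  qed
  also have "exp (2 * real N * A) * exp (- (Q + 2 * real N * A)) = exp (- Q)"
    by (simp add: exp_add[symmetric])
  finally show ?thesis by (simp add: r \<tau>_def)
qed
theorem lemma3p3:
  fixes M :: "'a measure" and X :: "int \<times> int \<Rightarrow> 'a \<Rightarrow> real"
  assumes "prob_space M"
    and "prob_space.indep_vars M (\<lambda>_. borel) X UNIV"
    and "\<And>v. distributed M lborel (X v) (\<lambda>s. ennreal (exponential_density 1 s))"
  shows "\<forall>\<epsilon>>0. \<exists>\<delta>>0. \<exists>t0::real. \<forall>m0>0. \<forall>t\<ge>t0. \<exists>N0::nat. \<forall>m\<in>{0..m0}. \<forall>N\<ge>N0.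
           measure M {\<omega> \<in> space M.
               (SUP x\<in>{x. real_pt (u_pt N x) \<in> I_seg N m \<delta>}.
                  T_val (\<lambda>v. X v \<omega>) N x - 4 * real N
                    + 2 powr (4 / 3) * real N powr (1 / 3) * x\<^sup>2)
               \<ge> 2 powr (4 / 3) * real N powr (1 / 3) * t}
           \<le> exp (- (4 / 3) * (1 - \<epsilon>) * t powr (3 / 2))"
proof (intro allI impI)
  fix \<epsilon> :: real
  assume \<epsilon>: "0 < \<epsilon>"
  show "\<exists>\<delta>>0. \<exists>t0::real. \<forall>m0>0. \<forall>t\<ge>t0. \<exists>N0::nat. \<forall>m\<in>{0..m0}. \<forall>N\<ge>N0.
           measure M {\<omega> \<in> space M.
               (SUP x\<in>{x. real_pt (u_pt N x) \<in> I_seg N m \<delta>}.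
                  T_val (\<lambda>v. X v \<omega>) N x - 4 * real N
                    + 2 powr (4 / 3) * real N powr (1 / 3) * x\<^sup>2)
               \<ge> 2 powr (4 / 3) * real N powr (1 / 3) * t}
           \<le> exp (- (4 / 3) * (1 - \<epsilon>) * t powr (3 / 2))"
  \<comment> \<open>The loss \<open>sqrt t / 2 + 1\<close> is at most \<open>2 * sqrt t\<close>, which \<open>\<epsilon> * t * sqrt t\<close> dominates once \<open>\<epsilon> * t \<ge> 2\<close>.\<close>
  proof (rule exI[of _ 1], rule conjI, simp, rule exI[of _ "1 + 2 / \<epsilon>"], intro allI impI)
    fix m0 t :: real
    assume m0: "0 < m0" and t: "1 + 2 / \<epsilon> \<le> t"
    define C where "C = 2 * (m0 + 1)"
    define \<sigma> where "\<sigma> = 2 powr (- 1 / 3) * sqrt t"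
    define H where "H = Max {2 * C + 1, 8 * \<sigma>,
      2 * \<sigma> + 10 * \<sigma> ^ 3 * C + 64 * \<sigma> ^ 5 + 2 * \<sigma> * C ^ 4}"
    have t1: "1 \<le> t" using t \<epsilon> by (smt (verit) divide_pos_pos)
    have \<epsilon>t: "2 \<le> \<epsilon> * t"
    proof -
      have "\<epsilon> * (1 + 2 / \<epsilon>) \<le> \<epsilon> * t" using t \<epsilon> by (intro mult_left_mono) auto
      then show ?thesis using \<epsilon> by (simp add: ring_distribs)
    qed
    have t32: "t powr (3 / 2) = t * sqrt t"
      using t1 powr_add[of t 1 "1 / 2"] by (simp add: powr_half_sqrt)
    have "1 \<le> sqrt t" using t1 by simp
    moreover have "2 * sqrt t \<le> \<epsilon> * t * sqrt t" using \<epsilon>t t1 by (intro mult_right_mono) auto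
    moreover have "4 / 3 * (1 - \<epsilon>) * (t * sqrt t) =
        4 / 3 * (t * sqrt t) - 4 / 3 * (\<epsilon> * t * sqrt t)"
      by (simp only: left_diff_distrib right_diff_distrib mult_1_right mult_1 mult.assoc)
    ultimately have Q: "4 / 3 * (1 - \<epsilon>) * (t * sqrt t) \<le> 4 / 3 * (t * sqrt t) - sqrt t / 2 - 1"
      by linarith
    obtain N0 :: nat where N0: "H ^ 3 \<le> real N0" using real_arch_simple by blast
    show "\<exists>N0::nat. \<forall>m\<in>{0..m0}. \<forall>N\<ge>N0.
           measure M {\<omega> \<in> space M.
               (SUP x\<in>{x. real_pt (u_pt N x) \<in> I_seg N m 1}.
                  T_val (\<lambda>v. X v \<omega>) N x - 4 * real N
                    + 2 powr (4 / 3) * real N powr (1 / 3) * x\<^sup>2)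
               \<ge> 2 powr (4 / 3) * real N powr (1 / 3) * t}
           \<le> exp (- (4 / 3) * (1 - \<epsilon>) * t powr (3 / 2))"
    proof (intro exI[of _ N0] ballI allI impI)
      fix m N assume m: "m \<in> {0..m0}" and N: "N0 \<le> N"
      have "2 * C + 1 \<le> H" unfolding H_def by (intro Max_ge) auto
      then have H0: "0 < H" using m0 by (simp add: C_def)
      have "(H ^ 3) powr (1 / 3) = H powr (real 3 * (1 / 3))"
        by (simp only: powr_realpow[OF H0, symmetric] powr_powr)
      then have "H = (H ^ 3) powr (1 / 3)" using H0 by simp
      also have "\<dots> \<le> real N powr (1 / 3)"
        using N0 N H0 by (intro powr_mono2) auto
      finally have H: "H \<le> real N powr (1 / 3)" .
      have large: "2 * C + 1 \<le> real N powr (1 / 3)" "8 * \<sigma> \<le> real N powr (1 / 3)"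
          "2 * \<sigma> + 10 * \<sigma> ^ 3 * C + 64 * \<sigma> ^ 5 + 2 * \<sigma> * C ^ 4 \<le> real N powr (1 / 3)"
        using H unfolding H_def by simp_all
      show "measure M {\<omega> \<in> space M.
               (SUP x\<in>{x. real_pt (u_pt N x) \<in> I_seg N m 1}.
                  T_val (\<lambda>v. X v \<omega>) N x - 4 * real N
                    + 2 powr (4 / 3) * real N powr (1 / 3) * x\<^sup>2)
               \<ge> 2 powr (4 / 3) * real N powr (1 / 3) * t}
           \<le> exp (- (4 / 3) * (1 - \<epsilon>) * t powr (3 / 2))"
        using segment_tail[OF assms t1 _ _ refl \<sigma>_def C_def large Q, of m] m
        unfolding t32 by simp
    qed
  qed
qed

end
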